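(* Let $\kappa<\lambda$ be cardinals and suppose $\kappa$ is measurable. Then there exists a regular ultrafilter $D$ on a set $I$, $|I|=\lambda$, which is ($\lambda$-)flexible but not good; specifically, $D$ is not good for any theory with $SOP_2$, i.e. for no countable complete theory $T$ with $SOP_2$ is it the case that $M^I/D$ is $\lambda^+$-saturated for every $M\models T$.
   Context: All languages are countable. A filter $D$ on a set $I$ with $|I|=\lambda$ is regular if there are $X_i \in D$ ($i<\lambda$) such that each $t\in I$ belongs to only finitely many $X_i$. A filter $D$ on $I$ is $\lambda$-flexible if for every $f: I \to \mathbb{N}$ such that $\{t\in I : f(t)>n\}\in D$ for all $n \in \mathbb{N}$, there are $X_\alpha \in D$ ($\alpha<\lambda$) with $|\{\alpha<\lambda : t\in X_\alpha\}| \le f(t)$ for all $t\in I$. A filter $D$ on $I$ is $\mu^+$-good if every $f:[\mu]^{<\aleph_0}\to D$ has a multiplicative refinement, i.e. there is $g:[\mu]^{<\aleph_0}\to D$ with $g(u)\subseteq f(u)$ and $g(u)\cap g(v)=g(u\cup v)$ for all finite $u,v\subseteq\mu$; $D$ is good if it is $|I|^+$-good. A theory $T$ has $SOP_2$ if there is a formula $\varphi(x;\bar y)$ such that in any $\aleph_1$-saturated $M\models T$ there are $\langle \bar a_\eta : \eta\in{}^{\omega>}2\rangle$ (indexed by finite binary sequences) such that (1) for $\eta,\rho$ incomparable under initial segment, $\{\varphi(x;\bar a_\eta),\varphi(x;\bar a_\rho)\}$ is inconsistent, and (2) for every $\eta\in{}^\omega2$, $\{\varphi(x;\bar a_{\eta|_i})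 : i<\omega\}$ is consistent. An uncountable cardinal $\kappa$ is measurable if there is a $\kappa$-complete nonprincipal ultrafilter on $\kappa$. *)

theory Defs
  imports Main "HOL-Library.FuncSet" "HOL-Library.Sublist"
begin

unbundle cardinal_syntax

section \<open>Ultrafilters\<close>

text \<open>A filter on the set \<open>I\<close> is a value of the library's filter type that lies below
  \<open>principal I\<close>; \<open>fsets I D\<close> is the same filter as a family of subsets of \<open>I\<close>.\<close>

definition fsets :: "'i set \<Rightarrow> 'i filter \<Rightarrow> 'i set set" where
  "fsets I D = {X. X \<subseteq> I \<and> eventually (\<lambda>t. t \<in> X) D}"

definition ultrafilter_on :: "'i set \<Rightarrow> 'i filter \<Rightarrow> bool" where
  "ultrafilter_on I D \<longleftrightarrow> D \<noteq> bot \<and> D \<le> principal I \<and>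
     (\<forall>X. X \<subseteq> I \<longrightarrow> X \<in> fsets I D \<or> I - X \<in> fsets I D)"

text \<open>Cardinals are the library's cardinal orders. A family indexed by the ordinals below
  \<open>\<mu>\<close> is a family indexed by \<open>Field \<mu>\<close>, and one indexed by the ordinals below
  the cardinality of \<open>I\<close> is indexed by \<open>I\<close> itself. Cardinality bounds by a natural number need an
  explicit finiteness condition, because \<open>card\<close> is \<open>0\<close> on infinite sets.\<close>

definition regular_filter :: "'i set \<Rightarrow> 'i filter \<Rightarrow> bool" where
  "regular_filter I D \<longleftrightarrow>
     (\<exists>X. (\<forall>i\<in>I. X i \<in> fsets I D) \<and> (\<forall>t\<in>I. finite {i \<in> I. t \<in> X i}))"

definition flexible :: "'c rel \<Rightarrow> 'i set \<Rightarrow> 'i filter \<Rightarrow> bool" where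
  "flexible \<mu> I D \<longleftrightarrow>
     (\<forall>f :: 'i \<Rightarrow> nat. (\<forall>n. {t \<in> I. f t > n} \<in> fsets I D) \<longrightarrow>
        (\<exists>X. (\<forall>\<alpha>\<in>Field \<mu>. X \<alpha> \<in> fsets I D) \<and>
             (\<forall>t\<in>I. finite {\<alpha> \<in> Field \<mu>. t \<in> X \<alpha>} \<and>
                    card {\<alpha> \<in> Field \<mu>. t \<in> X \<alpha>} \<le> f t)))"

text \<open>\<open>succ_good \<mu> I D\<close> is goodness of \<open>D\<close> for the successor cardinal of \<open>\<mu>\<close>.\<close>

definition succ_good :: "'c rel \<Rightarrow> 'i set \<Rightarrow> 'i filter \<Rightarrow> bool" where
  "succ_good \<mu> I D \<longleftrightarrow>
     (\<forall>f. f \<in> Fpow (Field \<mu>) \<rightarrow> fsets I D \<longrightarrow>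
        (\<exists>g. g \<in> Fpow (Field \<mu>) \<rightarrow> fsets I D \<and>
             (\<forall>u\<in>Fpow (Field \<mu>). g u \<subseteq> f u) \<and>
             (\<forall>u\<in>Fpow (Field \<mu>). \<forall>v\<in>Fpow (Field \<mu>). g u \<inter> g v = g (u \<union> v))))"

definition good :: "'i set \<Rightarrow> 'i filter \<Rightarrow> bool" where
  "good I D \<longleftrightarrow> succ_good |I| I D"

definition measurable_cardinal :: "'k rel \<Rightarrow> bool" where
  "measurable_cardinal \<kappa> \<longleftrightarrow> Card_order \<kappa> \<and> natLeq <o \<kappa> \<and>
     (\<exists>U. ultrafilter_on (Field \<kappa>) U \<and>
          (\<forall>a\<in>Field \<kappa>. {a} \<notin> fsets (Field \<kappa>) U) \<and>
          (\<forall>\<A>. \<A> \<subseteq> fsets (Field \<kappa>) U \<and> \<A> \<noteq> {} \<and> |\<A>| <o \<kappa> \<longrightarrow>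
                \<Inter>\<A> \<in> fsets (Field \<kappa>) U))"


section \<open>First-order logic in countable languages\<close>

text \<open>Symbols are natural numbers, so every language is countable. The arity maps return
  \<open>None\<close> for symbols outside the language; constants are function symbols of arity \<open>0\<close>.\<close>

record language =
  fun_ar :: "nat \<Rightarrow> nat option"
  rel_ar :: "nat \<Rightarrow> nat option"

datatype tm = Var nat | Fn nat "tm list"

datatype fm = Eq tm tm | Rel nat "tm list" | Neg fm | Conj fm fm | Exists nat fm

fun wf_tm :: "language \<Rightarrow> tm \<Rightarrow> bool" where
  "wf_tm L (Var x) = True"
| "wf_tm L (Fn F ts) = (fun_ar L F = Some (length ts) \<and> (\<forall>t\<in>set ts. wf_tm L t))"

fun wf_fm :: "language \<Rightarrow> fm \<Rightarrow> bool" where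
  "wf_fm L (Eq s t) = (wf_tm L s \<and> wf_tm L t)"
| "wf_fm L (Rel R ts) = (rel_ar L R = Some (length ts) \<and> (\<forall>t\<in>set ts. wf_tm L t))"
| "wf_fm L (Neg \<phi>) = wf_fm L \<phi>"
| "wf_fm L (Conj \<phi> \<psi>) = (wf_fm L \<phi> \<and> wf_fm L \<psi>)"
| "wf_fm L (Exists x \<phi>) = wf_fm L \<phi>"

fun vars_tm :: "tm \<Rightarrow> nat set" where
  "vars_tm (Var x) = {x}"
| "vars_tm (Fn F ts) = (\<Union>t\<in>set ts. vars_tm t)"

fun free_vars :: "fm \<Rightarrow> nat set" where
  "free_vars (Eq s t) = vars_tm s \<union> vars_tm t"
| "free_vars (Rel R ts) = (\<Union>t\<in>set ts. vars_tm t)"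
| "free_vars (Neg \<phi>) = free_vars \<phi>"
| "free_vars (Conj \<phi> \<psi>) = free_vars \<phi> \<union> free_vars \<psi>"
| "free_vars (Exists x \<phi>) = free_vars \<phi> - {x}"

record 'a struct =
  univ :: "'a set"
  fun_in :: "nat \<Rightarrow> 'a list \<Rightarrow> 'a"
  rel_in :: "nat \<Rightarrow> 'a list \<Rightarrow> bool"

definition is_struct :: "language \<Rightarrow> 'a struct \<Rightarrow> bool" where
  "is_struct L M \<longleftrightarrow> univ M \<noteq> {} \<and>
     (\<forall>F as. fun_ar L F = Some (length as) \<and> set as \<subseteq> univ M \<longrightarrow> fun_in M F as \<in> univ M)"

fun tm_val :: "'a struct \<Rightarrow> (nat \<Rightarrow> 'a) \<Rightarrow> tm \<Rightarrow> 'a" where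
  "tm_val M e (Var x) = e x"
| "tm_val M e (Fn F ts) = fun_in M F (map (tm_val M e) ts)"

fun sat :: "'a struct \<Rightarrow> (nat \<Rightarrow> 'a) \<Rightarrow> fm \<Rightarrow> bool" where
  "sat M e (Eq s t) = (tm_val M e s = tm_val M e t)"
| "sat M e (Rel R ts) = rel_in M R (map (tm_val M e) ts)"
| "sat M e (Neg \<phi>) = (\<not> sat M e \<phi>)"
| "sat M e (Conj \<phi> \<psi>) = (sat M e \<phi> \<and> sat M e \<psi>)"
| "sat M e (Exists x \<phi>) = (\<exists>a\<in>univ M. sat M (e(x := a)) \<phi>)"

definition sentences :: "language \<Rightarrow> fm set" where
  "sentences L = {\<phi>. wf_fm L \<phi> \<and> free_vars \<phi> = {}}"

definition true_in :: "'a struct \<Rightarrow> fm \<Rightarrow> bool" where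
  "true_in M \<phi> \<longleftrightarrow> (\<forall>e. range e \<subseteq> univ M \<longrightarrow> sat M e \<phi>)"

definition is_model :: "language \<Rightarrow> fm set \<Rightarrow> 'a struct \<Rightarrow> bool" where
  "is_model L T M \<longleftrightarrow> is_struct L M \<and> (\<forall>\<phi>\<in>T. true_in M \<phi>)"

text \<open>HOL cannot quantify over the universes of all structures at once. Notions that speak of all
  models of a theory therefore take a type argument and range over all structures whose universe is
  a subset of that type. By the Loewenheim-Skolem theorem, completeness does not depend on the
  type as long as it is infinite.\<close>

definition entails :: "'m itself \<Rightarrow> language \<Rightarrow> fm set \<Rightarrow> fm \<Rightarrow> bool" where
  "entails _ L T \<phi> \<longleftrightarrow> (\<forall>M :: 'm struct. is_model L T M \<longrightarrow> true_in M \<phi>)"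

definition complete_theory :: "'m itself \<Rightarrow> language \<Rightarrow> fm set \<Rightarrow> bool" where
  "complete_theory U L T \<longleftrightarrow> T \<subseteq> sentences L \<and> (\<exists>M :: 'm struct. is_model L T M) \<and>
     (\<forall>\<phi>\<in>sentences L. entails U L T \<phi> \<or> entails U L T (Neg \<phi>))"


section \<open>Types, saturation and ultrapowers\<close>

text \<open>A pair \<open>(\<phi>, e)\<close> stands for the formula obtained from \<open>\<phi>\<close> by keeping the variable \<open>0\<close> as
  the object variable and replacing every other free variable \<open>y\<close> by the parameter \<open>e y\<close>.\<close>

type_synonym 'a inst = "fm \<times> (nat \<Rightarrow> 'a)"

definition realizes :: "'a struct \<Rightarrow> 'a \<Rightarrow> 'a inst set \<Rightarrow> bool" where
  "realizes M b p \<longleftrightarrow> (\<forall>(\<phi>, e)\<in>p. sat M (e(0 := b)) \<phi>)"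

text \<open>Consistency with the elementary diagram of \<open>M\<close>.\<close>

definition consistent_in :: "'a struct \<Rightarrow> 'a inst set \<Rightarrow> bool" where
  "consistent_in M p \<longleftrightarrow> (\<forall>q. q \<subseteq> p \<and> finite q \<longrightarrow> (\<exists>b\<in>univ M. realizes M b q))"

definition type_over :: "language \<Rightarrow> 'a struct \<Rightarrow> 'a set \<Rightarrow> 'a inst set \<Rightarrow> bool" where
  "type_over L M A p \<longleftrightarrow> consistent_in M p \<and>
     (\<forall>(\<phi>, e)\<in>p. wf_fm L \<phi> \<and> (\<forall>y\<in>free_vars \<phi> - {0}. e y \<in> A))"

definition saturated :: "'c rel \<Rightarrow> language \<Rightarrow> 'a struct \<Rightarrow> bool" where
  "saturated \<mu> L M \<longleftrightarrow>
     (\<forall>A p. A \<subseteq> univ M \<and> |A| <o \<mu> \<and> type_over L M A p \<longrightarrow> (\<exists>b\<in>univ M. realizes M b p))"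

definition ae_equal :: "'i set \<Rightarrow> 'i filter \<Rightarrow> 'a struct \<Rightarrow> ('i \<Rightarrow> 'a) rel" where
  "ae_equal I D M = {(g, h). g \<in> I \<rightarrow>\<^sub>E univ M \<and> h \<in> I \<rightarrow>\<^sub>E univ M \<and>
                             eventually (\<lambda>t. g t = h t) D}"

text \<open>In the interpretations below, \<open>hs\<close> is a list of representatives of the classes \<open>Xs\<close>.\<close>

definition ultrapower :: "'i set \<Rightarrow> 'i filter \<Rightarrow> 'a struct \<Rightarrow> ('i \<Rightarrow> 'a) set struct" where
  "ultrapower I D M =
     \<lparr>univ = (I \<rightarrow>\<^sub>E univ M) // ae_equal I D M,
      fun_in = (\<lambda>F Xs. {g \<in> I \<rightarrow>\<^sub>E univ M. \<exists>hs. list_all2 (\<in>) hs Xs \<and>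
                          eventually (\<lambda>t. g t = fun_in M F (map (\<lambda>h. h t) hs)) D}),
      rel_in = (\<lambda>R Xs. \<exists>hs. list_all2 (\<in>) hs Xs \<and>
                          eventually (\<lambda>t. rel_in M R (map (\<lambda>h. h t) hs)) D)\<rparr>"


section \<open>The property \<open>SOP\<^sub>2\<close>\<close>

text \<open>Finite binary sequences are lists and infinite ones are functions on \<open>nat\<close>. The parameter
  tuple at a node \<open>\<eta>\<close> is given by an assignment \<open>a \<eta>\<close>, of which only the values at
  the finitely many free variables of \<open>\<phi>\<close> other than \<open>0\<close> matter. A countable theory has
  \<open>\<aleph>\<^sub>1\<close>-saturated models of cardinality at most that of the continuum, so the quantifier over
  \<open>M\<close> has its intended meaning whenever the type \<open>'m\<close> has at least that cardinality.\<close>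

definition SOP2 :: "'m itself \<Rightarrow> language \<Rightarrow> fm set \<Rightarrow> bool" where
  "SOP2 _ L T \<longleftrightarrow>
     (\<exists>\<phi>. wf_fm L \<phi> \<and>
        (\<forall>M :: 'm struct. is_model L T M \<and> saturated (cardSuc natLeq) L M \<longrightarrow>
           (\<exists>a :: bool list \<Rightarrow> nat \<Rightarrow> 'm.
              (\<forall>\<eta>. range (a \<eta>) \<subseteq> univ M) \<and>
              (\<forall>\<eta> \<rho>. \<eta> \<parallel> \<rho> \<longrightarrow> \<not> consistent_in M {(\<phi>, a \<eta>), (\<phi>, a \<rho>)}) \<and>
              (\<forall>\<eta> :: nat \<Rightarrow> bool. consistent_in M {(\<phi>, a (map \<eta> [0..<i])) | i. True}))))"

end

theory Submission
  imports Defs "HOL-Library.Countable_Set_Type"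
begin

text \<open>The ultrafilter is an iterated product. Let \<open>F\<close> be a regular and flexible ultrafilter on
\<open>\<lambda>\<close> and \<open>U\<close> a \<open>\<kappa>\<close>-complete nonprincipal ultrafilter on \<open>\<kappa>\<close>, and let \<open>D\<close> consist of the
sets \<open>X \<subseteq> \<lambda> \<times> \<kappa>\<close> whose section at \<open>t\<close> lies in \<open>F\<close> for \<open>U\<close>-almost all \<open>t\<close>. Regularity of \<open>D\<close>
comes from the first coordinate. If \<open>f\<close> exceeds every \<open>n\<close> almost everywhere for \<open>D\<close>, then, because \<open>U\<close>
is countably complete, almost every section of \<open>f\<close> exceeds every \<open>n\<close> almost everywhere for \<open>F\<close>,
and the families given by flexibility of \<open>F\<close> for the single sections fit together
(\<open>flexible_fubini\<close>).

The failure of saturation comes from \<open>U\<close>. Let \<open>j : V \<rightarrow> Ult(V, U)\<close> be the ultrapower embedding. The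
ultrapower is closed under \<open>\<kappa>\<close>-sequences, so it contains \<open>j``\<alpha>\<close> for every \<open>\<alpha> < \<kappa>\<^sup>+\<close>, but it does
not contain \<open>j``\<kappa>\<^sup>+\<close>. Hence the characteristic functions of the sets \<open>j``\<alpha>\<close> form an increasing
branch of length \<open>\<kappa>\<^sup>+\<close> in a binary tree of the ultrapower, and this branch has no upper bound there. The
lemma \<open>coherent_family\<close> says this directly in terms of representatives \<open>u \<alpha> t\<close> of the sets
\<open>j``\<alpha>\<close>. Regularity of \<open>F\<close> then brings the branch down to finite binary sequences: a regular family of
\<open>F\<close> leaves only finitely many \<open>\<alpha>\<close> active at an index \<open>(s, t)\<close>, and the finite forest of their
characteristic functions embeds into the finite binary sequences (\<open>forest_embedding\<close>).

The outcome is an unbounded branch for \<open>D\<close>: sequences of nodes that are pairwise comparable almost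
everywhere, but for which there are no sets in \<open>D\<close>, one for each \<open>\<alpha>\<close>, on which they are comparable
everywhere. A multiplicative refinement of ``the nodes in \<open>u\<close> are pairwise comparable'' would provide such
sets, so \<open>D\<close> is not good. In an ultrapower of a model with an \<open>SOP\<^sub>2\<close> tree, the
formulas attached to the nodes form a type over at most \<open>\<lambda>\<close> parameters, and a realization of this type would
provide such sets as well, because incomparable nodes carry contradictory formulas.

The definition of \<open>SOP\<^sub>2\<close> promises a tree only in \<open>\<aleph>\<^sub>1\<close>-saturated models. One whose universe fits
into the given type is an ultrapower, over the natural numbers, of a countable elementary submodel.

The ultrafilter \<open>F\<close> is built from an independent family of \<open>2\<^sup>\<lambda>\<close> functions into the finite
subsets of \<open>\<lambda>\<close>. All functions \<open>f : \<lambda> \<rightarrow> \<nat>\<close> are treated one after the other. If \<open>f\<close> cannot be made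
constant, then it can be made to exceed every \<open>n\<close>, and one fresh member of the independent family
becomes the family that flexibility asks for. Each step uses up countably many members only.\<close>

unbundle cardinal_syntax
unbundle lattice_syntax

section \<open>Independent families and flexible ultrafilters\<close>

lemma card_of_lists_infinite:
  assumes "infinite A"
  shows "|lists A| \<le>o |A|"
proof -
  have len: "|{l \<in> lists A. length l = n}| \<le>o |A|" for n
  proof (induction n)
    case 0
    have "A \<noteq> {}" using assms by auto
    have "{l \<in> lists A. length l = 0} = {[]}" by auto
    then show ?case using card_of_singl_ordLeq[OF \<open>A \<noteq> {}\<close>] by metis
  next
    case (Suc n)
    let ?L = "{l \<in> lists A. length l = n}"
    have eq: "{l \<in> lists A. length l = Suc n} = (\<lambda>(a, l). a # l) ` (A \<times> ?L)"
      by (auto simp: length_Suc_conv image_iff) 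
    have "|{l \<in> lists A. length l = Suc n}| \<le>o |A \<times> ?L|"
      unfolding eq by (rule card_of_image)
    also have "|A \<times> ?L| \<le>o |A|"
      using Suc assms by (intro card_of_Sigma_ordLeq_infinite) (auto intro: card_of_refl ordIso_imp_ordLeq)
    finally show ?case .
  qed
  have "lists A = (\<Union>n. {l \<in> lists A. length l = n})" by auto
  moreover have "|\<Union>n. {l \<in> lists A. length l = n}| \<le>o |A|"
    using len assms infinite_iff_card_of_nat by (intro card_of_UNION_ordLeq_infinite) auto
  ultimately show ?thesis by simp
qed

lemma card_of_Fpow_infinite:
  assumes "infinite A"
  shows "|Fpow A| \<le>o |A|"
proof -
  have "Fpow A = set ` lists A"
    unfolding Fpow_def using Collect_finite_subset_eq_lists[of A] by (simp add: conj_commute)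
  then show ?thesis
    using card_of_image[of set "lists A"] card_of_lists_infinite[OF assms] ordLeq_transitive by metis
qed

lemma card_of_Times_le_infinite:
  assumes "infinite C" "|A| \<le>o |C|" "|B| \<le>o |C|"
  shows "|A \<times> B| \<le>o |C|"
  using card_of_Sigma_ordLeq_infinite[OF assms(1,2), of "\<lambda>_. B"] assms(3) by simp

text \<open>All finitely many prescribed values are taken simultaneously on a set that is positive for \<open>D\<close>. The
members of \<open>R\<close> are the ones still available when \<open>D\<close> has been enlarged.\<close>

definition independent :: "('a \<Rightarrow> 'i \<Rightarrow> 'v) \<Rightarrow> 'v set \<Rightarrow> 'i filter \<Rightarrow> 'a set \<Rightarrow> bool" where
  "independent g V D R \<longleftrightarrow>
     (\<forall>S \<sigma>. finite S \<and> S \<subseteq> R \<and> \<sigma> \<in> S \<rightarrow> V \<longrightarrow> (\<exists>\<^sub>F t in D. \<forall>A\<in>S. g A t = \<sigma> A))"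

lemma independentD:
  "independent g V D R \<Longrightarrow> finite S \<Longrightarrow> S \<subseteq> R \<Longrightarrow> \<sigma> \<in> S \<rightarrow> V \<Longrightarrow> \<exists>\<^sub>F t in D. \<forall>A\<in>S. g A t = \<sigma> A"
  unfolding independent_def by blast

lemma independent_mono: "independent g V D R \<Longrightarrow> R' \<subseteq> R \<Longrightarrow> independent g V D R'"
  unfolding independent_def by blast

lemma independent_nontrivial:
  assumes "independent g V D R"
  shows "D \<noteq> bot"
  using independentD[OF assms, of "{}" undefined] by (auto simp: frequently_def)

text \<open>An index codes a finite set \<open>F\<close> together with a finite table that assigns values to subsets of
\<open>F\<close>, and the function belonging to \<open>A\<close> looks up \<open>A \<inter> F\<close>. Finitely many different sets \<open>A\<close> have
different traces on a suitable \<open>F\<close>, so their values can be prescribed at will. There are only \<open>|I|\<close> codes.\<close>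

theorem Engelking_Karlowicz:
  fixes I :: "'i set"
  assumes "infinite I"
  shows "\<exists>g :: 'i set \<Rightarrow> 'i \<Rightarrow> 'i set. independent g (Fpow I) (principal I) (Pow I) \<and>
           (\<forall>A. \<forall>t. g A t \<in> Fpow I)"
proof -
  let ?V = "Fpow I"
  let ?J = "?V \<times> Fpow (?V \<times> ?V)"
  have V: "|?V| \<le>o |I|" using card_of_Fpow_infinite[OF assms] .
  have VV: "|?V \<times> ?V| \<le>o |I|" using card_of_Times_le_infinite[OF assms V V] .
  have "infinite ?V"
  proof
    assume "finite ?V"
    moreover have "(\<lambda>x. {x}) ` I \<subseteq> ?V" unfolding Fpow_def by auto
    ultimately have "finite ((\<lambda>x. {x}) ` I)" using finite_subset by blast
    then show False using assms by (metis finite_imageD inj_on_def singleton_inject)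
  qed
  then have "infinite (?V \<times> ?V)" by (metis finite_cartesian_productD1 Fpow_not_empty)
  then have "|Fpow (?V \<times> ?V)| \<le>o |?V \<times> ?V|" by (rule card_of_Fpow_infinite)
  then have "|Fpow (?V \<times> ?V)| \<le>o |I|" using VV ordLeq_transitive by blast
  then have "|?J| \<le>o |I|" using card_of_Times_le_infinite[OF assms V] by blast
  moreover have ne: "?J \<noteq> {}" by (simp add: Fpow_not_empty)
  ultimately have "\<exists>p. p ` I = ?J" by (intro iffD2[OF card_of_ordLeq2[OF ne]])
  then obtain p where p: "p ` I = ?J" ..
  define g where "g = (\<lambda>A t. let v = SOME v. (A \<inter> fst (p t), v) \<in> snd (p t) in if v \<in> ?V then v else {})"
  have gV: "g A t \<in> ?V" for A t unfolding g_def Let_def using empty_in_Fpow by auto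
  have "\<exists>\<^sub>F t in principal I. \<forall>A\<in>S. g A t = \<sigma> A"
    if S: "finite S" "S \<subseteq> Pow I" "\<sigma> \<in> S \<rightarrow> ?V" for S \<sigma>
  proof -
    define d where "d = (\<lambda>A B :: 'i set. SOME x. x \<in> (A - B) \<union> (B - A))"
    define F where "F = {d A B | A B. A \<in> S \<and> B \<in> S \<and> A \<noteq> B}"
    have d: "d A B \<in> (A - B) \<union> (B - A)" if "A \<noteq> B" for A B
      unfolding d_def by (rule someI_ex) (use that in blast)
    have "F \<subseteq> (\<lambda>(A,B). d A B) ` (S \<times> S)" unfolding F_def by auto
    then have "finite F" using S(1) finite_subset by blast
    moreover have "F \<subseteq> I" unfolding F_def using d S(2) by blast
    ultimately have F: "F \<in> ?V" unfolding Fpow_def by auto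
    have sep: "A = B" if "A \<in> S" "B \<in> S" "A \<inter> F = B \<inter> F" for A B
    proof (rule ccontr)
      assume "A \<noteq> B"
      then have "d A B \<in> F" unfolding F_def using that by blast
      then show False using d[OF \<open>A \<noteq> B\<close>] that(3) by blast
    qed
    define Q where "Q = (\<lambda>A. (A \<inter> F, \<sigma> A)) ` S"
    have "finite Q" unfolding Q_def using S by blast
    moreover have "Q \<subseteq> ?V \<times> ?V"
      unfolding Q_def using S(3) \<open>finite F\<close> \<open>F \<subseteq> I\<close> unfolding Fpow_def Pi_def by auto
    ultimately have "Q \<in> Fpow (?V \<times> ?V)" unfolding Fpow_def by blast
    then have "(F, Q) \<in> p ` I" using F p by blast
    then obtain t where t: "t \<in> I" "p t = (F, Q)" by auto
    have "g A t = \<sigma> A" if A: "A \<in> S" for A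
    proof -
      have ex: "(A \<inter> F, v) \<in> Q \<longleftrightarrow> v = \<sigma> A" for v
        unfolding Q_def using A sep by auto
      then show ?thesis unfolding g_def t(2) Let_def using A S(3) by auto
    qed
    then show ?thesis using t(1) unfolding frequently_def eventually_principal by blast
  qed
  then show ?thesis using gV unfolding independent_def by blast
qed

text \<open>One member \<open>g a\<close> is spent on a family of sets indexed by \<open>I\<close> in which a point \<open>t\<close> lies in at most as
many sets as \<open>g a t\<close> has elements. With \<open>\<Phi>\<close> trivial this is regularity; with \<open>\<Phi> t v\<close> bounding
\<open>card v\<close> by \<open>f t\<close> it is flexibility for \<open>f\<close>. Finitely many of the new sets are met where
\<open>g a\<close> takes the finite set of their indices as its value.\<close>

lemma independent_add_family:
  fixes g :: "'a \<Rightarrow> 't \<Rightarrow> 'i set"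
  assumes ind: "independent g (Fpow I) D R" and a: "a \<in> R"
    and \<Phi>: "\<And>v. v \<in> Fpow I \<Longrightarrow> eventually (\<lambda>t. \<Phi> t v) D"
  shows "\<exists>D'\<le>D. independent g (Fpow I) D' (R - {a}) \<and>
           (\<forall>\<alpha>\<in>I. eventually (\<lambda>t. \<alpha> \<in> g a t \<and> \<Phi> t (g a t)) D')"
proof -
  let ?X = "\<lambda>v. {t. v \<subseteq> g a t \<and> \<Phi> t (g a t)}"
  define D' where "D' = D \<sqinter> (\<Sqinter>v\<in>Fpow I. principal (?X v))"
  have ev: "\<exists>P v. eventually P D \<and> v \<in> Fpow I \<and> (\<forall>t. P t \<and> t \<in> ?X v \<longrightarrow> Q t)"
    if Q: "eventually Q D'" for Q
  proof -
    obtain P P' where PP: "eventually P D" "eventually P' (\<Sqinter>v\<in>Fpow I. principal (?X v))"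
        "\<And>t. P t \<and> P' t \<Longrightarrow> Q t"
      using Q unfolding D'_def eventually_inf by blast
    have "\<exists>v\<in>Fpow I. eventually P' (principal (?X v))"
    proof (subst eventually_INF_base[symmetric])
      show "Fpow I \<noteq> {}" by (rule Fpow_not_empty)
      show "\<exists>x\<in>Fpow I. principal (?X x) \<le> principal (?X v) \<sqinter> principal (?X w)"
        if "v \<in> Fpow I" "w \<in> Fpow I" for v w
        using that by (intro bexI[of _ "v \<union> w"]) (auto simp: Fpow_def)
    qed (fact PP(2))
    then show ?thesis using PP unfolding eventually_principal by blast
  qed
  have "independent g (Fpow I) D' (R - {a})"
    unfolding independent_def
  proof (intro allI impI, elim conjE)
    fix S and \<sigma> :: "'a \<Rightarrow> 'i set"
    assume S: "finite S" "S \<subseteq> R - {a}" "\<sigma> \<in> S \<rightarrow> Fpow I"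
    show "\<exists>\<^sub>F t in D'. \<forall>A\<in>S. g A t = \<sigma> A"
    proof (rule ccontr)
      assume "\<not> ?thesis"
      then have "eventually (\<lambda>t. \<not> (\<forall>A\<in>S. g A t = \<sigma> A)) D'" by (simp add: not_frequently)
      from ev[OF this] obtain P v where P: "eventually P D" "v \<in> Fpow I"
        "\<And>t. P t \<Longrightarrow> t \<in> ?X v \<Longrightarrow> \<not> (\<forall>A\<in>S. g A t = \<sigma> A)" by blast
      have fr: "\<exists>\<^sub>F t in D. \<forall>A\<in>insert a S. g A t = (\<sigma>(a := v)) A"
        by (rule independentD[OF ind]) (use S a P(2) in auto)
      have "\<exists>\<^sub>F t in D. (\<forall>A\<in>insert a S. g A t = (\<sigma>(a := v)) A) \<and> P t \<and> \<Phi> t v"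
        by (rule frequently_rev_mp[OF fr]) (use P(1) \<Phi>[OF P(2)] in \<open>eventually_elim, blast\<close>)
      then obtain t where t: "\<forall>A\<in>insert a S. g A t = (\<sigma>(a := v)) A" "P t" "\<Phi> t v"
        using frequently_ex by blast
      moreover have "g A t = \<sigma> A" if "A \<in> S" for A
      proof -
        have "A \<noteq> a" using that S(2) by blast
        then show ?thesis using t(1) that by simp
      qed
      ultimately show False using P(3)[of t] by simp
    qed
  qed
  moreover have "eventually (\<lambda>t. \<alpha> \<in> g a t \<and> \<Phi> t (g a t)) D'" if "\<alpha> \<in> I" for \<alpha>
  proof -
    have "{\<alpha>} \<in> Fpow I" using that unfolding Fpow_def by auto
    then have "D' \<le> principal (?X {\<alpha>})" unfolding D'_def by (intro le_infI2 INF_lower)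
    then show ?thesis unfolding le_principal by simp
  qed
  moreover have "D' \<le> D" unfolding D'_def by simp
  ultimately show ?thesis by blast
qed

text \<open>If no value \<open>n\<close> of \<open>f\<close> can be forced while keeping independence, then each value can be excluded by
fixing finitely many members of the family. Doing this for \<open>n = 0, 1, 2, \<dots>\<close> costs countably many members, and
independence of the others survives the limit because a set of the limit filter is already forced at a
finite stage.\<close>

lemma independent_decide:
  fixes f :: "'i \<Rightarrow> nat" and g :: "'a \<Rightarrow> 'i \<Rightarrow> 'v"
  assumes ind: "independent g V D R"
  shows "\<exists>D'\<le>D. \<exists>C. countable C \<and> independent g V D' (R - C) \<and>
           ((\<exists>n. eventually (\<lambda>t. f t = n) D') \<or> (\<forall>n. eventually (\<lambda>t. f t > n) D'))"
proof -
  let ?cyl = "\<lambda>S \<sigma>. {t. \<forall>A\<in>S. g A t = \<sigma> A}"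
  define valid where "valid = (\<lambda>S \<sigma>. finite S \<and> S \<subseteq> R \<and> \<sigma> \<in> S \<rightarrow> V)"
  show ?thesis
  proof (cases "\<exists>S \<sigma> n. valid S \<sigma> \<and>
      independent g V (D \<sqinter> principal (?cyl S \<sigma>) \<sqinter> principal {t. f t = n}) (R - S)")
    case True
    then obtain S \<sigma> n where S: "valid S \<sigma>"
      "independent g V (D \<sqinter> principal (?cyl S \<sigma>) \<sqinter> principal {t. f t = n}) (R - S)" by blast
    have "eventually (\<lambda>t. f t = n) (D \<sqinter> principal (?cyl S \<sigma>) \<sqinter> principal {t. f t = n})"
      by (simp add: eventually_inf_principal)
    then show ?thesis using S countable_finite[of S]
      by (intro exI[of _ "D \<sqinter> principal (?cyl S \<sigma>) \<sqinter> principal {t. f t = n}"] conjI exI[of _ S])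
        (auto simp: valid_def le_infI1)
  next
    case False
    have step: "\<exists>S' \<sigma>'. valid S' \<sigma>' \<and> S \<subseteq> S' \<and> (\<forall>A\<in>S. \<sigma>' A = \<sigma> A) \<and>
        eventually (\<lambda>t. t \<in> ?cyl S' \<sigma>' \<longrightarrow> f t \<noteq> n) D" if S: "valid S \<sigma>" for S \<sigma> n
    proof -
      have "\<not> independent g V (D \<sqinter> principal (?cyl S \<sigma>) \<sqinter> principal {t. f t = n}) (R - S)"
        using False S by blast
      then obtain T \<tau> where T: "finite T" "T \<subseteq> R - S" "\<tau> \<in> T \<rightarrow> V"
        and "\<not> (\<exists>\<^sub>F t in D \<sqinter> principal (?cyl S \<sigma>) \<sqinter> principal {t. f t = n}. \<forall>A\<in>T. g A t = \<tau> A)"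
        unfolding independent_def by blast
      then have ev: "eventually (\<lambda>t. f t = n \<longrightarrow> t \<in> ?cyl S \<sigma> \<longrightarrow> \<not> (\<forall>A\<in>T. g A t = \<tau> A)) D"
        by (auto simp: not_frequently eventually_inf_principal elim!: eventually_mono)
      let ?\<sigma> = "\<lambda>A. if A \<in> S then \<sigma> A else \<tau> A"
      have "t \<in> ?cyl (S \<union> T) ?\<sigma> \<Longrightarrow> t \<in> ?cyl S \<sigma> \<and> (\<forall>A\<in>T. g A t = \<tau> A)" for t
        using T(2) by auto
      then have "eventually (\<lambda>t. t \<in> ?cyl (S \<union> T) ?\<sigma> \<longrightarrow> f t \<noteq> n) D"
        by (intro eventually_mono[OF ev]) blast
      moreover have "valid (S \<union> T) ?\<sigma>" using S T unfolding valid_def by auto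
      ultimately show ?thesis by (intro exI[of _ "S \<union> T"] exI[of _ ?\<sigma>]) auto
    qed
    have "\<exists>F. \<forall>n. valid (fst (F n)) (snd (F n)) \<and> (fst (F n) \<subseteq> fst (F (Suc n)) \<and>
        (\<forall>A\<in>fst (F n). snd (F (Suc n)) A = snd (F n) A) \<and>
        eventually (\<lambda>t. t \<in> ?cyl (fst (F (Suc n))) (snd (F (Suc n))) \<longrightarrow> f t \<noteq> n) D)"
    proof (rule dependent_nat_choice)
      show "\<exists>x. valid (fst x) (snd x)" by (rule exI[of _ "({}, undefined)"]) (simp add: valid_def)
      show "\<exists>y. valid (fst y) (snd y) \<and> fst x \<subseteq> fst y \<and> (\<forall>A\<in>fst x. snd y A = snd x A) \<and>
          eventually (\<lambda>t. t \<in> ?cyl (fst y) (snd y) \<longrightarrow> f t \<noteq> n) D"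
        if x: "valid (fst x) (snd x)" for x n
      proof -
        obtain S' \<sigma>' where "valid S' \<sigma>'" "fst x \<subseteq> S'" "\<forall>A\<in>fst x. \<sigma>' A = snd x A"
            "eventually (\<lambda>t. t \<in> ?cyl S' \<sigma>' \<longrightarrow> f t \<noteq> n) D"
          using step[OF x, of n] by blast
        then show ?thesis by (intro exI[of _ "(S', \<sigma>')"]) simp
      qed
    qed
    then obtain F where F_all: "\<forall>n. valid (fst (F n)) (snd (F n)) \<and> (fst (F n) \<subseteq> fst (F (Suc n)) \<and>
        (\<forall>A\<in>fst (F n). snd (F (Suc n)) A = snd (F n) A) \<and>
        eventually (\<lambda>t. t \<in> ?cyl (fst (F (Suc n))) (snd (F (Suc n))) \<longrightarrow> f t \<noteq> n) D)" ..
    note F_n = spec[OF F_all]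
    note F = conjunct1[OF F_n] conjunct1[OF conjunct2[OF F_n]]
      bspec[OF conjunct1[OF conjunct2[OF conjunct2[OF F_n]]]]
      conjunct2[OF conjunct2[OF conjunct2[OF F_n]]]
    let ?Y = "\<lambda>n. ?cyl (fst (F n)) (snd (F n))"
    have dec: "?Y m \<subseteq> ?Y n" if "n \<le> m" for n m
    proof (rule lift_Suc_antimono_le[OF _ that])
      show "?Y (Suc n) \<subseteq> ?Y n" for n
      proof
        fix t assume t: "t \<in> ?Y (Suc n)"
        have "g A t = snd (F n) A" if A: "A \<in> fst (F n)" for A
        proof -
          have "g A t = snd (F (Suc n)) A" using t F(2)[of n] A by blast
          then show ?thesis using F(3)[OF A] by simp
        qed
        then show "t \<in> ?Y n" by blast
      qed
    qed
    define D' where "D' = D \<sqinter> (\<Sqinter>n. principal (?Y n))"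
    define C where "C = (\<Union>n. fst (F n))"
    have "countable C" unfolding C_def using F(1) unfolding valid_def by (auto intro: countable_finite)
    have ev: "\<exists>P n. eventually P D \<and> (\<forall>t. P t \<and> t \<in> ?Y n \<longrightarrow> Q t)" if Q: "eventually Q D'" for Q
    proof -
      obtain P P' where PP: "eventually P D" "eventually P' (\<Sqinter>n. principal (?Y n))"
          "\<And>t. P t \<and> P' t \<Longrightarrow> Q t"
        using Q unfolding D'_def eventually_inf by blast
      have "\<exists>n\<in>UNIV. eventually P' (principal (?Y n))"
      proof (subst eventually_INF_base[symmetric])
        show "\<exists>x\<in>UNIV. principal (?Y x) \<le> principal (?Y v) \<sqinter> principal (?Y w)" for v w
          using dec[of v "max v w"] dec[of w "max v w"] by (intro bexI[of _ "max v w"]) auto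
      qed (use PP(2) in auto)
      then show ?thesis using PP unfolding eventually_principal by blast
    qed
    have Y: "eventually (\<lambda>t. t \<in> ?Y n) D'" for n
    proof -
      have "D' \<le> principal (?Y n)" unfolding D'_def by (intro le_infI2 INF_lower UNIV_I)
      then show ?thesis unfolding le_principal .
    qed
    have "D' \<le> D" unfolding D'_def by simp
    have "independent g V D' (R - C)"
      unfolding independent_def
    proof (intro allI impI, elim conjE)
      fix S and \<sigma> :: "'a \<Rightarrow> 'v"
      assume S: "finite S" "S \<subseteq> R - C" "\<sigma> \<in> S \<rightarrow> V"
      show "\<exists>\<^sub>F t in D'. \<forall>A\<in>S. g A t = \<sigma> A"
      proof (rule ccontr)
        assume "\<not> ?thesis"
        then have "eventually (\<lambda>t. \<not> (\<forall>A\<in>S. g A t = \<sigma> A)) D'" by (simp add: not_frequently)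
        from ev[OF this] obtain P n where P: "eventually P D"
          "\<And>t. P t \<Longrightarrow> t \<in> ?Y n \<Longrightarrow> \<not> (\<forall>A\<in>S. g A t = \<sigma> A)" by blast
        let ?T = "fst (F n)" let ?\<tau> = "\<lambda>A. if A \<in> ?T then snd (F n) A else \<sigma> A"
        have disj: "S \<inter> ?T = {}" using S(2) unfolding C_def by blast
        have fr: "\<exists>\<^sub>F t in D. \<forall>A\<in>S \<union> ?T. g A t = ?\<tau> A"
          by (rule independentD[OF ind]) (use S F(1)[of n] in \<open>auto simp: valid_def\<close>)
        have "\<exists>\<^sub>F t in D. (\<forall>A\<in>S \<union> ?T. g A t = ?\<tau> A) \<and> P t"
          by (rule frequently_rev_mp[OF fr]) (use P(1) in \<open>eventually_elim, blast\<close>)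
        then obtain t where "\<forall>A\<in>S \<union> ?T. g A t = ?\<tau> A" "P t" using frequently_ex by blast
        moreover from this have "\<forall>A\<in>S. g A t = \<sigma> A" using disj by fastforce
        ultimately show False using P(2)[of t] by auto
      qed
    qed
    moreover have "eventually (\<lambda>t. f t > n) D'" for n
    proof -
      have "eventually (\<lambda>t. f t \<noteq> k) D'" for k
        using Y[of "Suc k"] filter_leD[OF \<open>D' \<le> D\<close> F(4)[of k]] by eventually_elim blast
      then have "eventually (\<lambda>t. \<forall>k\<in>{..n}. f t \<noteq> k) D'" by (intro eventually_ball_finite) auto
      then show ?thesis by eventually_elim (metis atMost_iff not_le)
    qed
    ultimately show ?thesis using \<open>countable C\<close> \<open>D' \<le> D\<close> by blast
  qed
qed


text \<open>The limit step of the transfinite construction.\<close>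

lemma independent_Inf_chain:
  assumes "B \<noteq> {}" and chain: "\<And>D D'. D \<in> B \<Longrightarrow> D' \<in> B \<Longrightarrow> D \<le> D' \<or> D' \<le> D"
    and ind: "\<And>D. D \<in> B \<Longrightarrow> independent g V D R"
  shows "independent g V (Inf B) R"
  unfolding independent_def
proof (intro allI impI, elim conjE)
  fix S \<sigma> assume S: "finite S" "S \<subseteq> R" "\<sigma> \<in> S \<rightarrow> V"
  show "\<exists>\<^sub>F t in Inf B. \<forall>A\<in>S. g A t = \<sigma> A"
    unfolding frequently_def
  proof (subst eventually_Inf_base)
    show "\<exists>x\<in>B. x \<le> inf F G" if "F \<in> B" "G \<in> B" for F G
      using chain[OF that] that by (metis inf.absorb1 inf.absorb2 order_refl)
    show "\<not> (\<exists>b\<in>B. eventually (\<lambda>t. \<not> (\<forall>A\<in>S. g A t = \<sigma> A)) b)"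
      using independentD[OF ind S] unfolding frequently_def by blast
  qed (fact assms(1))
qed

text \<open>The second alternative is the conclusion of flexibility for \<open>f\<close>: the sets
\<open>{t. \<alpha> \<in> g a t \<and> card (g a t) \<le> f t}\<close> form the required family.\<close>

definition settled :: "('a \<Rightarrow> 'i \<Rightarrow> 'i set) \<Rightarrow> 'i set \<Rightarrow> ('i \<Rightarrow> nat) \<Rightarrow> 'i filter \<Rightarrow> bool" where
  "settled g I f D \<longleftrightarrow> (\<exists>n. eventually (\<lambda>t. f t = n) D) \<or>
     (\<exists>a. \<forall>\<alpha>\<in>I. eventually (\<lambda>t. \<alpha> \<in> g a t \<and> card (g a t) \<le> f t) D)"

lemma settled_mono: "settled g I f D \<Longrightarrow> D' \<le> D \<Longrightarrow> settled g I f D'"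
  unfolding settled_def by (meson filter_leD)

lemma independent_settle:
  fixes f :: "'i \<Rightarrow> nat"
  assumes ind: "independent g (Fpow I) D R" and unc: "uncountable R"
  shows "\<exists>D'\<le>D. \<exists>C. countable C \<and> independent g (Fpow I) D' (R - C) \<and> settled g I f D'"
proof -
  obtain D1 C where D1: "D1 \<le> D" "countable C" "independent g (Fpow I) D1 (R - C)"
    and cases: "(\<exists>n. eventually (\<lambda>t. f t = n) D1) \<or> (\<forall>n. eventually (\<lambda>t. f t > n) D1)"
    using independent_decide[OF ind, of f] by blast
  from cases show ?thesis
  proof
    assume "\<exists>n. eventually (\<lambda>t. f t = n) D1"
    then show ?thesis using D1 unfolding settled_def by blast
  next
    assume large: "\<forall>n. eventually (\<lambda>t. f t > n) D1"
    have "R - C \<noteq> {}" using unc D1(2) by (metis Diff_eq_empty_iff countable_subset)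
    then obtain a where a: "a \<in> R - C" by blast
    have "eventually (\<lambda>t. card v \<le> f t) D1" for v :: "'i set"
      by (rule eventually_mono[OF spec[OF large, of "card v"]]) simp
    then obtain D2 where D2: "D2 \<le> D1" "independent g (Fpow I) D2 (R - C - {a})"
      "\<forall>\<alpha>\<in>I. eventually (\<lambda>t. \<alpha> \<in> g a t \<and> card (g a t) \<le> f t) D2"
      using independent_add_family[OF D1(3) a, of "\<lambda>t v. card v \<le> f t"] by blast
    have "R - C - {a} = R - (insert a C)" by blast
    then show ?thesis using D1 D2 unfolding settled_def by (metis countable_insert order_trans)
  qed
qed

lemma card_of_funcset_nat:
  assumes "infinite I"
  shows "|I \<rightarrow>\<^sub>E (UNIV :: nat set)| \<le>o |Pow I|"
proof -
  have "|I \<times> (UNIV :: nat set)| \<le>o |I|"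
    using assms infinite_iff_card_of_nat[of I]
    by (intro card_of_Times_le_infinite[OF assms ordLeq_refl[OF card_of_Card_order]]) simp
  then obtain j where j: "inj_on j (I \<times> (UNIV :: nat set))" "j ` (I \<times> (UNIV :: nat set)) \<subseteq> I"
    unfolding card_of_ordLeq[symmetric] by blast
  let ?G = "\<lambda>f. (\<lambda>t. (t, f t)) ` I"
  show ?thesis
  proof (rule card_of_ordLeqI[where f = "\<lambda>f. j ` ?G f"])
    show "inj_on (\<lambda>f. j ` ?G f) (I \<rightarrow>\<^sub>E (UNIV :: nat set))"
    proof (rule inj_onI)
      fix f f' :: "'a \<Rightarrow> nat"
      assume f: "f \<in> I \<rightarrow>\<^sub>E UNIV" "f' \<in> I \<rightarrow>\<^sub>E UNIV" "j ` ?G f = j ` ?G f'"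
      then have "?G f = ?G f'" using inj_on_image_eq_iff[OF j(1), of "?G f" "?G f'"] by auto
      then have "f t = f' t" if "t \<in> I" for t using that by auto
      then show "f = f'" using f by (meson PiE_ext)
    qed
    show "j ` ?G f \<in> Pow I" for f using j(2) by auto
  qed
qed

text \<open>Fewer than \<open>|Pow I|\<close> steps that use up countably many members each leave uncountably many
members, which is what keeps the transfinite construction going.\<close>

lemma uncountable_Diff_UNION_underS:
  assumes I: "infinite I" and N: "\<And>y. y \<in> underS |Pow I| x \<Longrightarrow> countable (N y)"
  shows "uncountable (Pow I - {a} - (\<Union>y\<in>underS |Pow I| x. N y))" (is "uncountable (_ - _ - ?U)")
proof
  let ?L = "underS |Pow I| x"
  assume c: "countable (Pow I - {a} - ?U)"
  have small: "|A| <o |Pow I|" if "countable A" for A :: "'a set set"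
    using that I unfolding countable_card_of_nat infinite_iff_card_of_nat
    by (meson card_of_Pow ordLeq_ordLess_trans ordLeq_transitive)
  have inf: "infinite (Pow I)" using I by (simp add: finite_Pow_iff)
  have "|?U| <o |Pow I|"
  proof (cases "countable ?L")
    case True
    then show ?thesis using N by (intro small countable_UN) auto
  next
    case False
    then have "infinite ?L" using countable_finite by blast
    moreover have "|N y| \<le>o |?L|" if "y \<in> ?L" for y
      using N[OF that] \<open>infinite ?L\<close> unfolding countable_card_of_nat infinite_iff_card_of_nat
      using ordLeq_transitive by blast
    ultimately have "|?U| \<le>o |?L|" 
      by (intro card_of_UNION_ordLeq_infinite[OF _ ordLeq_refl[OF card_of_Card_order]]) blast+
    moreover obtain y where "y \<in> ?L" using infinite_imp_nonempty[OF \<open>infinite ?L\<close>] by blast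
    then have "x \<in> Field |Pow I|" unfolding underS_def Field_def by auto
    then have "|?L| <o |Pow I|" by (rule card_of_underS[OF card_of_Card_order])
    ultimately show ?thesis using ordLeq_ordLess_trans by blast
  qed
  moreover have "|insert a (Pow I - {a} - ?U)| <o |Pow I|" using c by (intro small) simp
  ultimately have "|?U \<union> insert a (Pow I - {a} - ?U)| <o |Pow I|"
    by (intro card_of_Un_ordLess_infinite[OF inf])
  moreover have "|Pow I| \<le>o |?U \<union> insert a (Pow I - {a} - ?U)|" by (rule card_of_mono1) blast
  ultimately show False using not_ordLess_ordLeq by blast
qed

text \<open>The transfinite recursion runs along the cardinal order of \<open>Pow I\<close>, which indexes both the
independent family and the functions to be settled. Settling characteristic functions makes the
filter an ultrafilter. The member with index \<open>{}\<close> is spent at the beginning, on regularity.\<close>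

theorem flexible_ultrafilter_exists:
  fixes I :: "'i set"
  assumes I: "infinite I"
  shows "\<exists>D. ultrafilter_on I D \<and> regular_filter I D \<and> (\<forall>\<mu>. Field \<mu> = I \<longrightarrow> flexible \<mu> I D)"
proof -
  obtain g :: "'i set \<Rightarrow> 'i \<Rightarrow> 'i set" where
    g: "independent g (Fpow I) (principal I) (Pow I)" "\<And>A t. g A t \<in> Fpow I"
    using Engelking_Karlowicz[OF I] by blast
  have gfin: "finite (g A t)" for A t using g(2) unfolding Fpow_def by blast
  obtain D0 where D0: "D0 \<le> principal I" "independent g (Fpow I) D0 (Pow I - {{}})"
    "\<And>\<alpha>. \<alpha> \<in> I \<Longrightarrow> eventually (\<lambda>t. \<alpha> \<in> g {} t) D0"
    using independent_add_family[OF g(1), of "{}" "\<lambda>_ _. True"] by auto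
  have "(I \<rightarrow>\<^sub>E (UNIV :: nat set)) \<noteq> {}" by (simp add: PiE_eq_empty_iff)
  then have "\<exists>q. q ` Pow I = (I \<rightarrow>\<^sub>E (UNIV :: nat set))"
    using card_of_funcset_nat[OF I] by (intro iffD2[OF card_of_ordLeq2])
  then obtain q where q: "q ` Pow I = (I \<rightarrow>\<^sub>E (UNIV :: nat set))" ..
  define r where "r = |Pow I|"
  have wo: "well_order_on (Pow I) r" unfolding r_def by (rule card_of_well_order_on)
  let ?R = "r - Id"
  have L: "underS r x = {y. (y, x) \<in> ?R}" for x unfolding underS_def by auto
  have wf: "wf ?R" using wo unfolding well_order_on_def by blast
  have trans: "trans ?R"
    using wo unfolding well_order_on_def linear_order_on_def partial_order_on_def preorder_on_def
    by (metis trans_diff_Id)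
  have total: "x = y \<or> (x, y) \<in> ?R \<or> (y, x) \<in> ?R" if "x \<in> Pow I" "y \<in> Pow I" for x y
    using wo that unfolding well_order_on_def linear_order_on_def total_on_def by blast
  have field: "x \<in> Pow I" "y \<in> Pow I" if "(x, y) \<in> ?R" for x y
    using that wo well_order_on_Field[OF wo] by (auto simp: Field_def)
  \<comment> \<open>The pair at \<open>x\<close> is the filter after step \<open>x\<close> and the countable set of members used in this step.\<close>
  define P where "P = (\<lambda>F x (D, N). D \<le> D0 \<and> (\<forall>y. (y, x) \<in> ?R \<longrightarrow> D \<le> fst (F y)) \<and> countable N \<and>
      independent g (Fpow I) D (Pow I - {{}} - (\<Union>y\<in>underS r x. snd (F y)) - N) \<and> settled g I (q x) D)"
  have "\<exists>F. \<forall>x. P F x (F x)"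
  proof (rule dependent_wf_choice[OF wf])
    show "P f x e = P h x e" if "\<And>z. (z, x) \<in> ?R \<Longrightarrow> f z = h z" for f h x e
    proof -
      have "(\<Union>y\<in>underS r x. snd (f y)) = (\<Union>y\<in>underS r x. snd (h y))" using that L by auto
      then show ?thesis using that unfolding P_def by (auto split: prod.splits)
    qed
    show "\<exists>e. P F x e" if IH: "\<And>y. (y, x) \<in> ?R \<Longrightarrow> P F y (F y)" for F x
    proof -
      let ?N = "\<Union>y\<in>underS r x. snd (F y)"
      let ?B = "insert D0 ((\<lambda>y. fst (F y)) ` underS r x)"
      have ind: "independent g (Fpow I) (Inf ?B) (Pow I - {{}} - ?N)"
      proof (rule independent_Inf_chain)
        show "D \<le> D' \<or> D' \<le> D" if "D \<in> ?B" "D' \<in> ?B" for D D'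
        proof -
          have "fst (F y) \<le> D0" if "y \<in> underS r x" for y
            using IH[of y] that L unfolding P_def by (auto split: prod.splits)
          moreover have "fst (F y) \<le> fst (F z) \<or> fst (F z) \<le> fst (F y)"
            if "y \<in> underS r x" "z \<in> underS r x" for y z
            using IH[of y] IH[of z] total[of y z] field[of y x] field[of z x] that L
            unfolding P_def by (auto split: prod.splits)
          ultimately show ?thesis using that by blast
        qed
        show "independent g (Fpow I) D (Pow I - {{}} - ?N)" if D: "D \<in> ?B" for D
        proof (cases "D = D0")
          case True
          show ?thesis unfolding True by (rule independent_mono[OF D0(2)]) blast
        next
          case False
          then obtain y where y: "y \<in> underS r x" "D = fst (F y)" using D by blast
          then have "independent g (Fpow I) D (Pow I - {{}} - (\<Union>z\<in>underS r y. snd (F z)) - snd (F y))"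
            using IH[of y] L unfolding P_def by (auto split: prod.splits)
          moreover have "underS r y \<subseteq> underS r x" using y(1) transD[OF trans] L by blast
          then have "(\<Union>z\<in>underS r y. snd (F z)) \<union> snd (F y) \<subseteq> ?N" using y(1) by blast
          ultimately show ?thesis by (elim independent_mono) blast
        qed
      qed auto
      have "countable (snd (F y))" if "y \<in> underS r x" for y
        using IH[of y] that L unfolding P_def by (auto split: prod.splits)
      then have "uncountable (Pow I - {{}} - ?N)"
        unfolding r_def by (rule uncountable_Diff_UNION_underS[OF I])
      then obtain D C where D: "D \<le> Inf ?B" "countable C"
          "independent g (Fpow I) D (Pow I - {{}} - ?N - C)" "settled g I (q x) D"
        using independent_settle[OF ind] by blast
      have "D \<le> D'" if "D' \<in> ?B" for D' using D(1) that by (meson Inf_lower order_trans)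
      then have "P F x (D, C)" using D L unfolding P_def by auto
      then show ?thesis by blast
    qed
  qed
  then obtain F where F: "\<And>x. P F x (F x)" by blast
  let ?B = "insert D0 ((\<lambda>y. fst (F y)) ` Pow I)"
  define D where "D = Inf ?B"
  have FD0: "fst (F x) \<le> D0" for x using F[of x] unfolding P_def by (auto split: prod.splits)
  have Fle: "fst (F x) \<le> fst (F y)" if "(y, x) \<in> ?R" for x y
    using F[of x] that unfolding P_def by (auto split: prod.splits)
  have "independent g (Fpow I) D {}"
    unfolding D_def
  proof (rule independent_Inf_chain)
    show "D1 \<le> D2 \<or> D2 \<le> D1" if "D1 \<in> ?B" "D2 \<in> ?B" for D1 D2
    proof -
      have "fst (F y) \<le> fst (F z) \<or> fst (F z) \<le> fst (F y)" if "y \<in> Pow I" "z \<in> Pow I" for y z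
        using total[OF that] Fle[of y z] Fle[of z y] by auto
      then show ?thesis using that FD0 by (elim insertE imageE) simp_all
    qed
    show "independent g (Fpow I) D1 {}" if D1: "D1 \<in> ?B" for D1
    proof (cases "D1 = D0")
      case True
      show ?thesis unfolding True by (rule independent_mono[OF D0(2)]) blast
    next
      case False
      then obtain y where "D1 = fst (F y)" using D1 by blast
      then have "independent g (Fpow I) D1 (Pow I - {{}} - (\<Union>z\<in>underS r y. snd (F z)) - snd (F y))"
        using F[of y] unfolding P_def by (auto split: prod.splits)
      then show ?thesis by (rule independent_mono) blast
    qed
  qed auto
  then have "D \<noteq> bot" by (rule independent_nontrivial)
  have DD0: "D \<le> D0" unfolding D_def by (rule Inf_lower) simp
  then have DI: "D \<le> principal I" using D0(1) by simp
  then have evI: "eventually (\<lambda>t. t \<in> I) D" unfolding le_principal .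
  have settled: "settled g I f D" if f: "f \<in> I \<rightarrow>\<^sub>E (UNIV :: nat set)" for f
  proof -
    obtain x where x: "x \<in> Pow I" "f = q x" using f q by blast
    have "D \<le> fst (F x)" unfolding D_def by (rule Inf_lower) (use x in blast)
    moreover have "settled g I f (fst (F x))" using F[of x] x unfolding P_def by (auto split: prod.splits)
    ultimately show ?thesis using settled_mono by blast
  qed
  have notFalse: "\<not> eventually (\<lambda>t. False) D" using \<open>D \<noteq> bot\<close> by simp
  have "ultrafilter_on I D"
    unfolding ultrafilter_on_def
  proof (intro conjI allI impI \<open>D \<noteq> bot\<close> DI)
    fix X assume X: "X \<subseteq> I"
    let ?f = "restrict (\<lambda>t. if t \<in> X then 1 else 0 :: nat) I"
    have "settled g I ?f D" by (rule settled) auto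
    then show "X \<in> fsets I D \<or> I - X \<in> fsets I D"
      unfolding settled_def
    proof (elim disjE exE)
      fix n assume n: "eventually (\<lambda>t. ?f t = n) D"
      show ?thesis
      proof (cases "n = 1")
        case True
        have "eventually (\<lambda>t. t \<in> X) D"
          using n evI by eventually_elim (simp add: True split: if_splits)
        then show ?thesis using X unfolding fsets_def by blast
      next
        case False
        have "eventually (\<lambda>t. t \<in> I - X) D"
          using n evI by eventually_elim (use False in auto)
        then show ?thesis using X unfolding fsets_def by blast
      qed
    next
      \<comment> \<open>Values at most \<open>1\<close> do not leave room for two different elements of \<open>g a t\<close>.\<close>
      fix a assume a: "\<forall>\<alpha>\<in>I. eventually (\<lambda>t. \<alpha> \<in> g a t \<and> card (g a t) \<le> ?f t) D"
      obtain \<alpha> \<beta> where "\<alpha> \<in> I" "\<beta> \<in> I" "\<alpha> \<noteq> \<beta>"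
        using I by (metis finite.emptyI finite_insert infinite_imp_nonempty subsetI subset_singletonD singletonI finite_subset ex_in_conv insertI1)
      then have "eventually (\<lambda>t. \<alpha> \<in> g a t \<and> card (g a t) \<le> ?f t) D"
          "eventually (\<lambda>t. \<beta> \<in> g a t \<and> card (g a t) \<le> ?f t) D" using a by blast+
      with evI have "eventually (\<lambda>t. False) D"
      proof eventually_elim
        case (elim t)
        then have "{\<alpha>, \<beta>} \<subseteq> g a t" "card (g a t) \<le> 1" by (auto split: if_splits)
        then have "card {\<alpha>, \<beta>} \<le> 1" using card_mono[OF gfin, of "{\<alpha>, \<beta>}" a t] by linarith
        then show False using \<open>\<alpha> \<noteq> \<beta>\<close> by simp
      qed
      then show ?thesis using notFalse by blast
    qed
  qed
  moreover have "regular_filter I D"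
    unfolding regular_filter_def
  proof (intro exI conjI ballI)
    show "{t \<in> I. i \<in> g {} t} \<in> fsets I D" if "i \<in> I" for i
      using filter_leD[OF DD0 D0(3)[OF that]] evI unfolding fsets_def by (auto elim: eventually_elim2)
    show "finite {i \<in> I. t \<in> {t \<in> I. i \<in> g {} t}}" for t
      by (rule finite_subset[OF _ gfin[of "{}" t]]) blast
  qed
  moreover have "flexible \<mu> I D" if \<mu>: "Field \<mu> = I" for \<mu>
    unfolding flexible_def \<mu>
  proof (intro allI impI)
    fix f :: "'i \<Rightarrow> nat" assume f: "\<forall>n. {t \<in> I. f t > n} \<in> fsets I D"
    have "settled g I (restrict f I) D" by (rule settled) auto
    then show "\<exists>X. (\<forall>\<alpha>\<in>I. X \<alpha> \<in> fsets I D) \<and>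
        (\<forall>t\<in>I. finite {\<alpha> \<in> I. t \<in> X \<alpha>} \<and> card {\<alpha> \<in> I. t \<in> X \<alpha>} \<le> f t)"
      unfolding settled_def
    proof (elim disjE exE)
      fix n assume n: "eventually (\<lambda>t. restrict f I t = n) D"
      have "eventually (\<lambda>t. t \<in> {t \<in> I. f t > n}) D" using f unfolding fsets_def by blast
      with n have "eventually (\<lambda>t. False) D" by eventually_elim auto
      then show ?thesis using notFalse by blast
    next
      fix a assume a: "\<forall>\<alpha>\<in>I. eventually (\<lambda>t. \<alpha> \<in> g a t \<and> card (g a t) \<le> restrict f I t) D"
      let ?X = "\<lambda>\<alpha>. {t \<in> I. \<alpha> \<in> g a t \<and> card (g a t) \<le> f t}"
      have X: "?X \<alpha> \<in> fsets I D" if "\<alpha> \<in> I" for \<alpha>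
      proof -
        have "eventually (\<lambda>t. \<alpha> \<in> g a t \<and> card (g a t) \<le> restrict f I t) D" using a that by blast
        with evI have "eventually (\<lambda>t. t \<in> ?X \<alpha>) D" by eventually_elim auto
        then show ?thesis unfolding fsets_def by blast
      qed
      have fin: "finite {\<alpha> \<in> I. t \<in> ?X \<alpha>} \<and> card {\<alpha> \<in> I. t \<in> ?X \<alpha>} \<le> f t" for t
      proof (cases "card (g a t) \<le> f t")
        case True
        have "{\<alpha> \<in> I. t \<in> ?X \<alpha>} \<subseteq> g a t" by blast
        then show ?thesis using gfin True by (meson card_mono finite_subset order_trans)
      next
        case False
        then have "{\<alpha> \<in> I. t \<in> ?X \<alpha>} = {}" by blast
        then show ?thesis by (metis card.empty finite.emptyI zero_le)
      qed
      show ?thesis by (rule exI[of _ ?X]) (intro conjI ballI X conjunct1[OF fin] conjunct2[OF fin])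
    qed
  qed
  ultimately show ?thesis by blast
qed

section \<open>The ultrapower by a complete ultrafilter\<close>

lemma ultrafilter_on_not:
  assumes "ultrafilter_on I D"
  shows "eventually (\<lambda>t. \<not> P t) D \<longleftrightarrow> \<not> eventually P D"
proof
  assume 1: "eventually (\<lambda>t. \<not> P t) D"
  show "\<not> eventually P D"
  proof
    assume "eventually P D"
    with 1 have "eventually (\<lambda>t. False) D" by eventually_elim blast
    then show False using assms unfolding ultrafilter_on_def by simp
  qed
next
  assume n: "\<not> eventually P D"
  have I: "eventually (\<lambda>t. t \<in> I) D" using assms unfolding ultrafilter_on_def le_principal by blast
  have "\<forall>X. X \<subseteq> I \<longrightarrow> X \<in> fsets I D \<or> I - X \<in> fsets I D"
    using assms unfolding ultrafilter_on_def by blast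
  from spec[OF this, of "{t \<in> I. P t}"]
  have "{t \<in> I. P t} \<in> fsets I D \<or> I - {t \<in> I. P t} \<in> fsets I D" by simp
  then show "eventually (\<lambda>t. \<not> P t) D"
  proof
    assume "{t \<in> I. P t} \<in> fsets I D"
    then have "eventually P D" unfolding fsets_def by (auto elim: eventually_mono)
    then show ?thesis using n by blast
  next
    assume "I - {t \<in> I. P t} \<in> fsets I D"
    then have "eventually (\<lambda>t. t \<in> I - {t \<in> I. P t}) D" unfolding fsets_def by blast
    then show ?thesis by eventually_elim blast
  qed
qed

lemma ultrafilter_on_ex:
  assumes "ultrafilter_on I D" "eventually P D"
  shows "\<exists>t\<in>I. P t"
proof (rule ccontr)
  assume n: "\<not> ?thesis"
  have "eventually (\<lambda>t. t \<in> I) D" using assms unfolding ultrafilter_on_def le_principal by blast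
  with assms(2) have "eventually (\<lambda>t. False) D" by eventually_elim (use n in blast)
  then show False using assms unfolding ultrafilter_on_def by simp
qed

lemma ultrafilter_on_carrier: "ultrafilter_on I D \<Longrightarrow> eventually (\<lambda>t. t \<in> I) D"
  unfolding ultrafilter_on_def le_principal by blast

lemma fsets_Collect_iff: "ultrafilter_on I D \<Longrightarrow> {t \<in> I. P t} \<in> fsets I D \<longleftrightarrow> eventually P D"
  using eventually_conj_iff[of "\<lambda>t. t \<in> I" P D] ultrafilter_on_carrier unfolding fsets_def by auto

lemma wf_strict_part: "Well_order r \<Longrightarrow> wf (r - Id)"
  unfolding well_order_on_def by blast

lemma underS_total:
  assumes "Well_order r" "a \<in> Field r" "b \<in> Field r"
  shows "a = b \<or> a \<in> underS r b \<or> b \<in> underS r a"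
  using assms unfolding well_order_on_def linear_order_on_def total_on_def underS_def by blast

lemma underS_trans:
  assumes "Well_order r" "a \<in> underS r b" "b \<in> underS r c"
  shows "a \<in> underS r c"
proof -
  have "trans (r - Id)"
    using assms(1) unfolding well_order_on_def linear_order_on_def partial_order_on_def preorder_on_def
    by (metis trans_diff_Id)
  then show ?thesis using assms(2,3) unfolding underS_def trans_def by blast
qed

lemma underS_Field_subset: "underS r a \<subseteq> Field r"
  unfolding underS_def Field_def by auto

locale complete_ultrafilter =
  fixes \<kappa> :: "'k rel" and U :: "'k filter"
  assumes Card_order: "Card_order \<kappa>" and uncountable: "natLeq <o \<kappa>"
    and ultrafilter: "ultrafilter_on (Field \<kappa>) U"
    and nonprincipal: "a \<in> Field \<kappa> \<Longrightarrow> {a} \<notin> fsets (Field \<kappa>) U"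
    and complete: "\<A> \<subseteq> fsets (Field \<kappa>) U \<Longrightarrow> \<A> \<noteq> {} \<Longrightarrow> |\<A>| <o \<kappa> \<Longrightarrow>
        \<Inter>\<A> \<in> fsets (Field \<kappa>) U"
begin

lemma Well_order: "Well_order \<kappa>"
  using Card_order unfolding card_order_on_def by blast

lemma Field_ordIso: "\<kappa> =o |Field \<kappa>|"
  by (rule ordIso_symmetric[OF card_of_Field_ordIso[OF Card_order]])

lemma infinite_Field: "infinite (Field \<kappa>)"
  using infinite_iff_natLeq_ordLeq[of "Field \<kappa>"]
    ordLess_imp_ordLeq[OF ordLess_ordIso_trans[OF uncountable Field_ordIso]] by argo

lemma countable_less: "countable A \<Longrightarrow> |A| <o \<kappa>"
  by (rule ordLeq_ordLess_trans[OF _ uncountable]) (simp add: countable_card_le_natLeq)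

lemma underS_less: "|underS \<kappa> a| <o \<kappa>"
proof (cases "a \<in> Field \<kappa>")
  case True
  then show ?thesis by (rule card_of_underS[OF Card_order])
next
  case False
  then have "underS \<kappa> a = {}" unfolding underS_def Field_def by auto
  then have "countable (underS \<kappa> a)" by simp
  then show ?thesis by (rule countable_less)
qed

lemma eventually_ball:
  assumes "|J| <o \<kappa>" and ev: "\<And>j. j \<in> J \<Longrightarrow> eventually (P j) U"
  shows "eventually (\<lambda>t. \<forall>j\<in>J. P j t) U"
proof (cases "J = {}")
  case False
  let ?A = "(\<lambda>j. {t \<in> Field \<kappa>. P j t}) ` J"
  have "?A \<subseteq> fsets (Field \<kappa>) U" using ev fsets_Collect_iff[OF ultrafilter] by blast
  moreover have "|?A| <o \<kappa>" by (rule ordLeq_ordLess_trans[OF card_of_image assms(1)])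
  ultimately have "\<Inter>?A \<in> fsets (Field \<kappa>) U" using False by (intro complete) auto
  then have "eventually (\<lambda>t. t \<in> \<Inter>?A) U" unfolding fsets_def by blast
  then show ?thesis by eventually_elim blast
qed simp

lemma eventually_bex:
  assumes "|J| <o \<kappa>" and ev: "eventually (\<lambda>t. \<exists>j\<in>J. P j t) U"
  shows "\<exists>j\<in>J. eventually (P j) U"
proof (rule ccontr)
  assume "\<not> ?thesis"
  then have "eventually (\<lambda>t. \<forall>j\<in>J. \<not> P j t) U"
    using assms(1) ultrafilter_on_not[OF ultrafilter] by (intro eventually_ball) blast+
  with ev have "eventually (\<lambda>t. False) U" by eventually_elim blast
  then show False using ultrafilter_on_ex[OF ultrafilter] by blast
qed

definition unbounded :: "('k \<Rightarrow> 'k) \<Rightarrow> bool" where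
  "unbounded h \<longleftrightarrow> (\<forall>i\<in>Field \<kappa>. eventually (\<lambda>t. i \<in> underS \<kappa> (h t)) U)"

text \<open>A function into \<open>\<kappa>\<close> that is bounded almost everywhere takes fewer than \<open>\<kappa>\<close> values, so by completeness one of
them is taken almost everywhere.\<close>

lemma bounded_constant:
  assumes h: "eventually (\<lambda>t. h t \<in> Field \<kappa>) U" and n: "\<not> unbounded h"
  shows "\<exists>i\<in>Field \<kappa>. eventually (\<lambda>t. h t = i) U"
proof -
  obtain i where i: "i \<in> Field \<kappa>" "eventually (\<lambda>t. i \<notin> underS \<kappa> (h t)) U"
    using n ultrafilter_on_not[OF ultrafilter] unfolding unbounded_def by blast
  let ?J = "insert i (underS \<kappa> i)"
  have "eventually (\<lambda>t. \<exists>j\<in>?J. h t = j) U"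
    using h i(2) by eventually_elim (use underS_total[OF Well_order i(1)] in blast)
  moreover have "|{i} \<union> underS \<kappa> i| <o \<kappa>"
    using infinite_Field Card_order countable_less[of "{i}"] underS_less
    by (intro card_of_Un_ordLess_infinite_Field) simp_all
  ultimately have "\<exists>j\<in>?J. eventually (\<lambda>t. h t = j) U" by (intro eventually_bex) simp_all
  then show ?thesis using i(1) underS_Field_subset by (metis insert_iff subsetD)
qed

lemma unbounded_id: "unbounded (\<lambda>t. t)"
proof (rule ccontr)
  assume "\<not> ?thesis"
  then obtain i where i: "i \<in> Field \<kappa>" "eventually (\<lambda>t. t = i) U"
    using bounded_constant[of "\<lambda>t. t"] ultrafilter_on_carrier[OF ultrafilter] by blast
  then have "{i} \<in> fsets (Field \<kappa>) U" unfolding fsets_def by simp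
  then show False using nonprincipal i(1) by blast
qed

text \<open>The function \<open>\<pi>\<close> represents the ordinal \<open>\<kappa>\<close> in the ultrapower by \<open>U\<close>; the ultrapower is wellfounded because
\<open>U\<close> is countably complete. Together with \<open>bounded_constant\<close>, this replaces normality of \<open>U\<close>:
functions below \<open>\<pi>\<close> are constant almost everywhere.\<close>

lemma least_unbounded:
  "\<exists>\<pi>. unbounded \<pi> \<and> (\<forall>h. eventually (\<lambda>t. h t \<in> underS \<kappa> (\<pi> t)) U \<longrightarrow> \<not> unbounded h)"
proof -
  let ?R = "{(h, h'). eventually (\<lambda>t. h t \<in> underS \<kappa> (h' t)) U}"
  have "wf ?R"
    unfolding wf_iff_no_infinite_down_chain
  proof
    assume "\<exists>f. \<forall>i. (f (Suc i), f i) \<in> ?R"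
    then obtain f where f: "\<And>i :: nat. eventually (\<lambda>t. f (Suc i) t \<in> underS \<kappa> (f i t)) U" by auto
    have "eventually (\<lambda>t. \<forall>i\<in>UNIV. f (Suc i) t \<in> underS \<kappa> (f i t)) U"
      using f by (intro eventually_ball countable_less) auto
    then obtain t where "\<forall>i. f (Suc i) t \<in> underS \<kappa> (f i t)" using ultrafilter_on_ex[OF ultrafilter] by blast
    then have "\<forall>i. (f (Suc i) t, f i t) \<in> \<kappa> - Id" unfolding underS_def by auto
    then have "\<exists>g. \<forall>i :: nat. (g (Suc i), g i) \<in> \<kappa> - Id" by (intro exI[of _ "\<lambda>i. f i t"])
    then show False using wf_strict_part[OF Well_order] unfolding wf_iff_no_infinite_down_chain by blast
  qed
  then obtain \<pi> where "\<pi> \<in> Collect unbounded" "\<And>h. (h, \<pi>) \<in> ?R \<Longrightarrow> h \<notin> Collect unbounded"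
    using wfE_min[of ?R "\<lambda>t. t" "Collect unbounded"] unbounded_id by blast
  then show ?thesis by blast
qed

end

text \<open>Otherwise \<open>\<kappa>\<close> would be isomorphic to a proper initial segment of \<open>b\<close>.\<close>

lemma small_initial_segments:
  assumes \<kappa>: "Card_order \<kappa>" and r: "Well_order r" and b: "b \<subseteq> Field r"
    and small: "\<And>x. x \<in> b \<Longrightarrow> |b \<inter> underS r x| <o \<kappa>"
  shows "|b| \<le>o \<kappa>"
proof (rule ccontr)
  assume nle: "\<not> ?thesis"
  have \<kappa>W: "Well_order \<kappa>" using \<kappa> unfolding card_order_on_def by blast
  have "\<kappa> <o |b|" using nle not_ordLeq_iff_ordLess[OF \<kappa>W card_of_Well_order] by blast
  moreover have wo: "well_order_on b (Restr r b)" using r b by (rule well_order_on_Restr)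
  then have "|b| \<le>o Restr r b" by (rule card_of_least)
  ultimately have less: "\<kappa> <o Restr r b" using ordLess_ordLeq_trans by blast
  have F: "Field (Restr r b) = b" using wo by (rule well_order_on_Field[symmetric])
  have "Well_order (Restr r b)" using wo F by simp
  then obtain x where x: "x \<in> Field (Restr r b)" "\<kappa> =o Restr (Restr r b) (underS (Restr r b) x)"
    using less ordLess_iff_ordIso_Restr[OF _ \<kappa>W] by blast
  let ?F = "Field (Restr (Restr r b) (underS (Restr r b) x))"
  have "?F \<subseteq> b \<inter> underS r x"
    unfolding Field_def underS_def by auto
  then have "|?F| \<le>o |b \<inter> underS r x|" by (rule card_of_mono1)
  then have "|?F| <o \<kappa>" by (rule ordLeq_ordLess_trans) (use small x(1) F in blast)
  moreover have "\<kappa> =o |?F|"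
    by (rule ordIso_transitive[OF ordIso_symmetric[OF card_of_Field_ordIso[OF \<kappa>]] card_of_cong[OF x(2)]])
  ultimately have "\<kappa> <o \<kappa>" by (rule ordIso_ordLess_trans[rotated])
  then show False using ordLess_irreflexive by blast
qed

text \<open>The set \<open>{x. |underS \<mu> x| \<le>o \<kappa>}\<close> plays the role of the ordinal \<open>\<kappa>\<^sup>+\<close> inside \<open>\<mu>\<close>.\<close>

lemma not_small_initial_part:
  assumes \<mu>: "Card_order \<mu>" and \<kappa>: "\<kappa> <o \<mu>"
  shows "\<not> |{x \<in> Field \<mu>. |underS \<mu> x| \<le>o \<kappa>}| \<le>o \<kappa>" (is "\<not> |?W| \<le>o \<kappa>")
proof
  assume W: "|?W| \<le>o \<kappa>"
  have wo: "Well_order \<mu>" using \<mu> unfolding card_order_on_def by blast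
  show False
  proof (cases "?W = Field \<mu>")
    case True
    then have "\<mu> \<le>o \<kappa>"
      using ordIso_ordLeq_trans[OF ordIso_symmetric[OF card_of_Field_ordIso[OF \<mu>]], of \<kappa>] W by simp
    then show False using \<kappa> not_ordLess_ordLeq by blast
  next
    case False
    then obtain z where z: "z \<in> Field \<mu> - ?W" by blast
    obtain w where w: "w \<in> Field \<mu> - ?W" and min: "\<And>y. (y, w) \<in> \<mu> - Id \<Longrightarrow> y \<notin> Field \<mu> - ?W"
      by (rule wfE_min[OF wf_strict_part[OF wo] z]) (rule that)
    have "underS \<mu> w \<subseteq> ?W"
    proof
      fix y assume y: "y \<in> underS \<mu> w"
      then have "(y, w) \<in> \<mu> - Id" "y \<in> Field \<mu>" unfolding underS_def Field_def by auto
      then show "y \<in> ?W" using min by blast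
    qed
    then have "|underS \<mu> w| \<le>o \<kappa>" by (rule ordLeq_transitive[OF card_of_mono1 W])
    then show False using w by blast
  qed
qed

context complete_ultrafilter
begin

text \<open>For an injection \<open>\<rho> \<alpha>\<close> of \<open>\<alpha>\<close> into \<open>\<kappa>\<close>, the set \<open>u \<alpha> t = {\<xi> < \<alpha>. \<rho> \<alpha> \<xi> < \<pi> t}\<close> represents
\<open>j``\<alpha>\<close> in the ultrapower by \<open>U\<close>. The third property expresses \<open>j``\<alpha> \<inter> j(\<beta>) = j``\<beta>\<close>. The last one
expresses that the ultrapower has no set extending all \<open>j``\<alpha>\<close>: sets \<open>Y \<alpha>\<close> of \<open>U\<close> on which the
\<open>u \<alpha> t\<close> cohere everywhere would allow to take the union \<open>b t\<close> of the \<open>u \<alpha> t\<close> with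
\<open>t \<in> Y \<alpha>\<close>. All proper initial segments of \<open>b t\<close> are smaller than \<open>\<kappa>\<close>, so \<open>b t\<close> has size at most
\<open>\<kappa>\<close>, and so has the union of the \<open>\<kappa>\<close> many sets \<open>b t\<close>. But every \<open>\<xi> < \<kappa>\<^sup>+\<close> belongs to
\<open>u \<alpha> t\<close> for \<open>\<alpha> > \<xi>\<close> and almost all \<open>t\<close>.\<close>

lemma coherent_family:
  fixes \<mu> :: "'i rel"
  assumes \<mu>: "Card_order \<mu>" and less: "\<kappa> <o \<mu>"
  obtains W and u :: "'i \<Rightarrow> 'k \<Rightarrow> 'i set"
  where "W \<subseteq> Field \<mu>"
    and "\<And>\<alpha> t. u \<alpha> t \<subseteq> underS \<mu> \<alpha>"
    and "\<And>\<alpha> \<beta>. \<alpha> \<in> W \<Longrightarrow> \<beta> \<in> W \<Longrightarrow> \<beta> \<in> underS \<mu> \<alpha> \<Longrightarrow>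
           eventually (\<lambda>t. u \<alpha> t \<inter> underS \<mu> \<beta> = u \<beta> t) U"
    and "\<forall>Y. (\<forall>\<alpha>\<in>W. eventually (\<lambda>t. t \<in> Y \<alpha>) U) \<longrightarrow>
           (\<exists>t\<in>Field \<kappa>. \<exists>\<alpha>\<in>W. \<exists>\<beta>\<in>W. t \<in> Y \<alpha> \<inter> Y \<beta> \<and> \<beta> \<in> underS \<mu> \<alpha> \<and> u \<alpha> t \<inter> underS \<mu> \<beta> \<noteq> u \<beta> t)"
proof -
  have wo: "Well_order \<mu>" using \<mu> unfolding card_order_on_def by blast
  obtain \<pi> where \<pi>: "unbounded \<pi>"
    and least: "\<And>h. eventually (\<lambda>t. h t \<in> underS \<kappa> (\<pi> t)) U \<Longrightarrow> \<not> unbounded h"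
    using least_unbounded by blast
  define W where "W = {x \<in> Field \<mu>. |underS \<mu> x| \<le>o \<kappa>}"
  have "\<exists>\<rho>. inj_on \<rho> (underS \<mu> \<alpha>) \<and> \<rho> ` underS \<mu> \<alpha> \<subseteq> Field \<kappa>" if "\<alpha> \<in> W" for \<alpha>
  proof -
    have "|underS \<mu> \<alpha>| \<le>o |Field \<kappa>|"
      by (rule ordLeq_ordIso_trans[OF _ Field_ordIso]) (use that in \<open>simp add: W_def\<close>)
    then show ?thesis unfolding card_of_ordLeq .
  qed
  then obtain \<rho> where \<rho>: "\<And>\<alpha>. \<alpha> \<in> W \<Longrightarrow> inj_on (\<rho> \<alpha>) (underS \<mu> \<alpha>)"
    "\<And>\<alpha>. \<alpha> \<in> W \<Longrightarrow> \<rho> \<alpha> ` underS \<mu> \<alpha> \<subseteq> Field \<kappa>" by metis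
  define u where "u = (\<lambda>\<alpha> t. {\<xi> \<in> underS \<mu> \<alpha>. \<rho> \<alpha> \<xi> \<in> underS \<kappa> (\<pi> t)})"
  have mem: "eventually (\<lambda>t. \<rho> \<alpha> \<xi> \<in> underS \<kappa> (\<pi> t)) U" if "\<alpha> \<in> W" "\<xi> \<in> underS \<mu> \<alpha>" for \<alpha> \<xi>
    using \<pi> \<rho>(2)[OF that(1)] that(2) unfolding unbounded_def by blast
  have small: "|u \<alpha> t| <o \<kappa>" if "\<alpha> \<in> W" for \<alpha> t
  proof -
    have "inj_on (\<rho> \<alpha>) (u \<alpha> t)" using \<rho>(1)[OF that] unfolding u_def by (rule inj_on_subset) blast
    then have "|u \<alpha> t| \<le>o |underS \<kappa> (\<pi> t)|" by (rule card_of_ordLeqI) (simp add: u_def)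
    then show ?thesis by (rule ordLeq_ordLess_trans[OF _ underS_less])
  qed
  show thesis
  proof
    show "W \<subseteq> Field \<mu>" unfolding W_def by blast
    show "u \<alpha> t \<subseteq> underS \<mu> \<alpha>" for \<alpha> t unfolding u_def by blast
  next
    fix \<alpha> \<beta> assume \<alpha>: "\<alpha> \<in> W" and \<beta>: "\<beta> \<in> W" and \<beta>\<alpha>: "\<beta> \<in> underS \<mu> \<alpha>"
    have sub: "underS \<mu> \<beta> \<subseteq> underS \<mu> \<alpha>" using underS_trans[OF wo _ \<beta>\<alpha>] by blast
    let ?bad = "\<lambda>t \<xi>. (\<rho> \<alpha> \<xi> \<in> underS \<kappa> (\<pi> t)) \<noteq> (\<rho> \<beta> \<xi> \<in> underS \<kappa> (\<pi> t))"
    show "eventually (\<lambda>t. u \<alpha> t \<inter> underS \<mu> \<beta> = u \<beta> t) U"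
    proof (rule ccontr)
      assume "\<not> ?thesis"
      then have "eventually (\<lambda>t. u \<alpha> t \<inter> underS \<mu> \<beta> \<noteq> u \<beta> t) U"
        using ultrafilter_on_not[OF ultrafilter] by blast
      then have ex: "eventually (\<lambda>t. \<exists>\<xi>\<in>underS \<mu> \<beta>. ?bad t \<xi>) U"
        by eventually_elim (use sub in \<open>auto simp: u_def\<close>)
      define \<xi> where "\<xi> = (\<lambda>t. SOME \<xi>. \<xi> \<in> underS \<mu> \<beta> \<and> ?bad t \<xi>)"
      have \<xi>: "eventually (\<lambda>t. \<xi> t \<in> underS \<mu> \<beta> \<and> ?bad t (\<xi> t)) U"
        using ex
      proof eventually_elim
        case (elim t)
        then have "\<exists>\<xi>. \<xi> \<in> underS \<mu> \<beta> \<and> ?bad t \<xi>" by blast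
        then show ?case unfolding \<xi>_def by (rule someI_ex)
      qed
      \<comment> \<open>Of the two codes of a point of disagreement, one is below \<open>\<pi> t\<close>, hence constant almost
        everywhere; as codes are injective, only two points of disagreement remain possible.\<close>
      define h where "h = (\<lambda>t. if \<rho> \<alpha> (\<xi> t) \<in> underS \<kappa> (\<pi> t) then \<rho> \<alpha> (\<xi> t) else \<rho> \<beta> (\<xi> t))"
      have h: "eventually (\<lambda>t. h t \<in> underS \<kappa> (\<pi> t)) U"
        using \<xi> by eventually_elim (auto simp: h_def)
      then have "eventually (\<lambda>t. h t \<in> Field \<kappa>) U"
        by eventually_elim (rule subsetD[OF underS_Field_subset])
      then obtain i where i: "eventually (\<lambda>t. h t = i) U" using bounded_constant least[OF h] by blast
      let ?J = "{\<xi> \<in> underS \<mu> \<beta>. \<rho> \<alpha> \<xi> = i \<or> \<rho> \<beta> \<xi> = i}"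
      have "?J \<subseteq> {inv_into (underS \<mu> \<alpha>) (\<rho> \<alpha>) i, inv_into (underS \<mu> \<beta>) (\<rho> \<beta>) i}"
      proof
        fix \<xi> assume "\<xi> \<in> ?J"
        then have "\<xi> \<in> underS \<mu> \<alpha>" "\<xi> \<in> underS \<mu> \<beta>" "\<rho> \<alpha> \<xi> = i \<or> \<rho> \<beta> \<xi> = i" using sub by auto
        then show "\<xi> \<in> {inv_into (underS \<mu> \<alpha>) (\<rho> \<alpha>) i, inv_into (underS \<mu> \<beta>) (\<rho> \<beta>) i}"
          using inv_into_f_f[OF \<rho>(1)[OF \<alpha>], of \<xi>] inv_into_f_f[OF \<rho>(1)[OF \<beta>], of \<xi>] by auto
      qed
      then have "finite ?J" by (rule finite_subset) simp
      then have "|?J| <o \<kappa>" by (intro countable_less countable_finite)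
      moreover have "eventually (\<lambda>t. \<exists>\<xi>\<in>?J. ?bad t \<xi>) U"
        using \<xi> i by eventually_elim (auto simp: h_def split: if_splits)
      ultimately obtain \<zeta> where \<zeta>: "\<zeta> \<in> ?J" "eventually (\<lambda>t. ?bad t \<zeta>) U"
        using eventually_bex[of ?J "\<lambda>\<zeta> t. ?bad t \<zeta>"] by blast
      then have "\<zeta> \<in> underS \<mu> \<beta>" "\<zeta> \<in> underS \<mu> \<alpha>" using sub by auto
      from \<zeta>(2) mem[OF \<alpha> this(2)] mem[OF \<beta> this(1)] have "eventually (\<lambda>t. False) U"
        by eventually_elim blast
      then show False using ultrafilter_on_ex[OF ultrafilter] by blast
    qed
  next
    have "\<exists>t\<in>Field \<kappa>. \<exists>\<alpha>\<in>W. \<exists>\<beta>\<in>W. t \<in> Y \<alpha> \<inter> Y \<beta> \<and> \<beta> \<in> underS \<mu> \<alpha> \<and> u \<alpha> t \<inter> underS \<mu> \<beta> \<noteq> u \<beta> t"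
      if Y: "\<And>\<alpha>. \<alpha> \<in> W \<Longrightarrow> eventually (\<lambda>t. t \<in> Y \<alpha>) U" for Y
    proof (rule ccontr)
      assume "\<not> ?thesis"
      then have coh: "u \<alpha> t \<inter> underS \<mu> \<beta> = u \<beta> t"
        if "t \<in> Field \<kappa>" "\<alpha> \<in> W" "\<beta> \<in> W" "t \<in> Y \<alpha>" "t \<in> Y \<beta>" "\<beta> \<in> underS \<mu> \<alpha>" for t \<alpha> \<beta>
        using that by blast
      define b where "b = (\<lambda>t. \<Union>\<alpha>\<in>{\<alpha> \<in> W. t \<in> Y \<alpha>}. u \<alpha> t)"
      have seg: "b t \<inter> underS \<mu> \<alpha> \<subseteq> u \<alpha> t" if t: "t \<in> Field \<kappa>" and \<alpha>: "\<alpha> \<in> W" "t \<in> Y \<alpha>" for t \<alpha>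
      proof
        fix \<zeta> assume \<zeta>: "\<zeta> \<in> b t \<inter> underS \<mu> \<alpha>"
        then obtain \<gamma> where \<gamma>: "\<gamma> \<in> W" "t \<in> Y \<gamma>" "\<zeta> \<in> u \<gamma> t" unfolding b_def by blast
        have "\<gamma> \<in> Field \<mu>" "\<alpha> \<in> Field \<mu>" using \<gamma>(1) \<alpha>(1) unfolding W_def by auto
        then consider "\<gamma> = \<alpha>" | "\<gamma> \<in> underS \<mu> \<alpha>" | "\<alpha> \<in> underS \<mu> \<gamma>"
          using underS_total[OF wo] by blast
        then show "\<zeta> \<in> u \<alpha> t"
          using \<gamma> \<zeta> coh[OF t \<alpha>(1) \<gamma>(1) \<alpha>(2) \<gamma>(2)] coh[OF t \<gamma>(1) \<alpha>(1) \<gamma>(2) \<alpha>(2)] by cases auto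
      qed
      have b: "|b t| \<le>o \<kappa>" if t: "t \<in> Field \<kappa>" for t
      proof (rule small_initial_segments[OF Card_order wo])
        show "b t \<subseteq> Field \<mu>" unfolding b_def u_def using underS_Field_subset by fast
        fix \<xi> assume "\<xi> \<in> b t"
        then obtain \<alpha> where \<alpha>: "\<alpha> \<in> W" "t \<in> Y \<alpha>" "\<xi> \<in> underS \<mu> \<alpha>" unfolding b_def u_def by blast
        have "b t \<inter> underS \<mu> \<xi> \<subseteq> u \<alpha> t" using seg[OF t \<alpha>(1,2)] underS_trans[OF wo _ \<alpha>(3)] by blast
        then have "|b t \<inter> underS \<mu> \<xi>| \<le>o |u \<alpha> t|" by (rule card_of_mono1)
        then show "|b t \<inter> underS \<mu> \<xi>| <o \<kappa>" by (rule ordLeq_ordLess_trans[OF _ small[OF \<alpha>(1)]])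
      qed
      let ?B = "\<Union>t\<in>Field \<kappa>. b t"
      have B: "|?B| \<le>o \<kappa>"
        using infinite_Field Card_order b card_of_Field_ordIso[OF Card_order]
        by (intro card_of_UNION_ordLeq_infinite_Field) (auto intro: ordIso_imp_ordLeq)
      have notW: "\<not> W \<subseteq> A" if "|A| \<le>o \<kappa>" for A
        using not_small_initial_part[OF \<mu> less] ordLeq_transitive[OF card_of_mono1[of W A] that]
        unfolding W_def by argo
      obtain \<xi> where \<xi>: "\<xi> \<in> W" "\<xi> \<notin> ?B" using notW[OF B] by blast
      have "|underS \<mu> \<xi> \<union> {\<xi>}| \<le>o \<kappa>"
        using infinite_Field Card_order \<xi>(1) countable_less[of "{\<xi>}"]
        by (intro card_of_Un_ordLeq_infinite_Field) (auto simp: W_def intro: ordLess_imp_ordLeq)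
      then obtain \<alpha> where \<alpha>: "\<alpha> \<in> W" "\<alpha> \<notin> underS \<mu> \<xi> \<union> {\<xi>}" using notW by blast
      then have \<xi>\<alpha>: "\<xi> \<in> underS \<mu> \<alpha>" using underS_total[OF wo, of \<alpha> \<xi>] \<xi>(1) unfolding W_def by blast
      have "eventually (\<lambda>t. \<xi> \<in> u \<alpha> t \<and> t \<in> Y \<alpha>) U"
        using mem[OF \<alpha>(1) \<xi>\<alpha>] Y[OF \<alpha>(1)] by eventually_elim (simp add: u_def \<xi>\<alpha>)
      then obtain t where "t \<in> Field \<kappa>" "\<xi> \<in> u \<alpha> t" "t \<in> Y \<alpha>" using ultrafilter_on_ex[OF ultrafilter] by blast
      then have "\<xi> \<in> ?B" using \<alpha>(1) unfolding b_def by blast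
      then show False using \<xi>(2) by blast
    qed
    then show "\<forall>Y. (\<forall>\<alpha>\<in>W. eventually (\<lambda>t. t \<in> Y \<alpha>) U) \<longrightarrow>
        (\<exists>t\<in>Field \<kappa>. \<exists>\<alpha>\<in>W. \<exists>\<beta>\<in>W. t \<in> Y \<alpha> \<inter> Y \<beta> \<and> \<beta> \<in> underS \<mu> \<alpha> \<and>
           u \<alpha> t \<inter> underS \<mu> \<beta> \<noteq> u \<beta> t)" by blast
  qed
qed

end

section \<open>Iterated products and unbounded branches\<close>

lemma sorted_list_of_finite_set:
  assumes r: "Well_order r" and "finite A" "A \<subseteq> Field r"
  shows "\<exists>ds. set ds = A \<and> sorted_wrt (\<lambda>a b. a \<in> underS r b) ds"
  using assms(2,3)
proof (induction A rule: finite_psubset_induct)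
  case (psubset A)
  show ?case
  proof (cases "A = {}")
    case True
    then show ?thesis by (intro exI[of _ "[]"]) simp
  next
    case False
    then obtain a where a: "a \<in> A" by blast
    obtain m where m: "m \<in> A" "\<And>y. (y, m) \<in> r - Id \<Longrightarrow> y \<notin> A"
      by (rule wfE_min[OF wf_strict_part[OF r] a]) (rule that)
    have min: "m \<in> underS r b" if "b \<in> A - {m}" for b
    proof -
      have "b \<in> Field r" "m \<in> Field r" using that m(1) psubset.prems by auto
      moreover have "b \<notin> underS r m" using m(2)[of b] that unfolding underS_def by auto
      ultimately show ?thesis using underS_total[OF r] that by blast
    qed
    obtain ds where "set ds = A - {m}" "sorted_wrt (\<lambda>a b. a \<in> underS r b) ds"
      using psubset.IH[of "A - {m}"] psubset.prems m(1) by blast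
    then show ?thesis using m(1) min by (intro exI[of _ "m # ds"]) auto
  qed
qed

lemma takeWhile_prefix_mono:
  assumes "\<And>x. x \<in> set xs \<Longrightarrow> P x \<Longrightarrow> Q x"
  shows "prefix (takeWhile P xs) (takeWhile Q xs)"
  using assms by (induction xs) auto

lemma sorted_takeWhile_mem:
  assumes "sorted_wrt R xs" "x \<in> set xs" "P x" and "\<And>a b. R a b \<Longrightarrow> P b \<Longrightarrow> P a"
  shows "x \<in> set (takeWhile P xs)"
  using assms by (induction xs) auto

text \<open>The sets \<open>u \<alpha>\<close> are characteristic functions on the initial segments below \<open>\<alpha>\<close>, ordered by extension. To embed
finitely many of them into the finite binary sequences, choose one point of disagreement for each
pair that is incomparable and record the values at the chosen points, in increasing order, as far as
they lie below \<open>\<alpha>\<close>.\<close>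

lemma forest_embedding:
  fixes u :: "'i \<Rightarrow> 'i set"
  assumes r: "Well_order r" and fin: "finite F" and u: "\<And>\<alpha>. u \<alpha> \<subseteq> underS r \<alpha>"
  shows "\<exists>e :: 'i \<Rightarrow> bool list. \<forall>\<alpha>\<in>F. \<forall>\<beta>\<in>F. \<beta> \<in> underS r \<alpha> \<longrightarrow>
           (e \<alpha> \<parallel> e \<beta> \<longleftrightarrow> u \<alpha> \<inter> underS r \<beta> \<noteq> u \<beta>)"
proof -
  define d where "d = (\<lambda>\<alpha> \<beta>. SOME \<delta>. \<delta> \<in> underS r \<beta> \<and> (\<delta> \<in> u \<alpha>) \<noteq> (\<delta> \<in> u \<beta>))"
  have d: "d \<alpha> \<beta> \<in> underS r \<beta> \<and> (d \<alpha> \<beta> \<in> u \<alpha>) \<noteq> (d \<alpha> \<beta> \<in> u \<beta>)"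
    if "u \<alpha> \<inter> underS r \<beta> \<noteq> u \<beta>" for \<alpha> \<beta>
  proof -
    have "\<exists>\<delta>. \<delta> \<in> underS r \<beta> \<and> (\<delta> \<in> u \<alpha>) \<noteq> (\<delta> \<in> u \<beta>)" using that u[of \<beta>] by blast
    then show ?thesis unfolding d_def by (rule someI_ex)
  qed
  let ?\<Delta> = "(\<lambda>(\<alpha>, \<beta>). d \<alpha> \<beta>) ` (F \<times> F) \<inter> Field r"
  obtain ds where ds: "set ds = ?\<Delta>" "sorted_wrt (\<lambda>a b. a \<in> underS r b) ds"
    using sorted_list_of_finite_set[OF r, of ?\<Delta>] fin by auto
  let ?l = "\<lambda>\<alpha>. takeWhile (\<lambda>\<delta>. \<delta> \<in> underS r \<alpha>) ds"
  define e where "e = (\<lambda>\<alpha>. map (\<lambda>\<delta>. \<delta> \<in> u \<alpha>) (?l \<alpha>))"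
  have "e \<alpha> \<parallel> e \<beta> \<longleftrightarrow> u \<alpha> \<inter> underS r \<beta> \<noteq> u \<beta>"
    if F: "\<alpha> \<in> F" "\<beta> \<in> F" and less: "\<beta> \<in> underS r \<alpha>" for \<alpha> \<beta>
  proof -
    have "prefix (?l \<beta>) (?l \<alpha>)"
      using underS_trans[OF r _ less] by (intro takeWhile_prefix_mono) blast
    then obtain ms where ms: "?l \<alpha> = ?l \<beta> @ ms" by (auto simp: prefix_def)
    have e\<alpha>: "e \<alpha> = map (\<lambda>\<delta>. \<delta> \<in> u \<alpha>) (?l \<beta>) @ map (\<lambda>\<delta>. \<delta> \<in> u \<alpha>) ms"
      unfolding e_def ms by simp
    show ?thesis
    proof (cases "u \<alpha> \<inter> underS r \<beta> = u \<beta>")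
      case True
      have "\<delta> \<in> u \<alpha> \<longleftrightarrow> \<delta> \<in> u \<beta>" if "\<delta> \<in> set (?l \<beta>)" for \<delta>
        using True set_takeWhileD[OF that] by blast
      then have "map (\<lambda>\<delta>. \<delta> \<in> u \<alpha>) (?l \<beta>) = e \<beta>" unfolding e_def by (intro map_cong) auto
      then have "prefix (e \<beta>) (e \<alpha>)" unfolding e\<alpha> by simp
      then show ?thesis using True by (auto simp: parallel_def)
    next
      case False
      let ?d = "d \<alpha> \<beta>"
      have "?d \<in> (\<lambda>(\<alpha>, \<beta>). d \<alpha> \<beta>) ` (F \<times> F)" using F by (intro image_eqI[of _ _ "(\<alpha>, \<beta>)"]) auto
      moreover have "?d \<in> Field r" using d[OF False] by (intro subsetD[OF underS_Field_subset]) auto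
      ultimately have "?d \<in> set ds" unfolding ds(1) by blast
      then have "?d \<in> set (?l \<beta>)"
        using d[OF False] underS_trans[OF r] by (intro sorted_takeWhile_mem[OF ds(2)]) auto
      then have neq: "map (\<lambda>\<delta>. \<delta> \<in> u \<alpha>) (?l \<beta>) \<noteq> e \<beta>" using d[OF False] unfolding e_def map_eq_conv by blast
      have len: "length (map (\<lambda>\<delta>. \<delta> \<in> u \<alpha>) (?l \<beta>)) = length (e \<beta>)" unfolding e_def by simp
      have "\<not> prefix (e \<beta>) (e \<alpha>)"
      proof
        assume "prefix (e \<beta>) (e \<alpha>)"
        then obtain zs where "map (\<lambda>\<delta>. \<delta> \<in> u \<alpha>) (?l \<beta>) @ map (\<lambda>\<delta>. \<delta> \<in> u \<alpha>) ms = e \<beta> @ zs"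
          unfolding e\<alpha> prefix_def by blast
        then show False using append_eq_append_conv[OF disjI1[OF len]] neq by blast
      qed
      moreover have "\<not> prefix (e \<alpha>) (e \<beta>)"
      proof
        assume "prefix (e \<alpha>) (e \<beta>)"
        then have "prefix (map (\<lambda>\<delta>. \<delta> \<in> u \<alpha>) (?l \<beta>)) (e \<beta>)" unfolding e\<alpha> by (rule append_prefixD)
        then obtain zs where zs: "e \<beta> = map (\<lambda>\<delta>. \<delta> \<in> u \<alpha>) (?l \<beta>) @ zs" by (auto simp: prefix_def)
        have "length zs = 0" using arg_cong[OF zs, of length] len by simp
        then show False using neq zs by simp
      qed
      ultimately show ?thesis using False by (auto simp: parallel_def)
    qed
  qed
  then show ?thesis by blast
qed

text \<open>The iterated product with \<open>G\<close> as the outer filter, transported to another index set along \<open>b\<close>.\<close>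

definition fubini :: "('s \<times> 't \<Rightarrow> 'i) \<Rightarrow> 's filter \<Rightarrow> 't filter \<Rightarrow> 'i filter" where
  "fubini b F G = Abs_filter (\<lambda>P. eventually (\<lambda>t. eventually (\<lambda>s. P (b (s, t))) F) G)"

lemma eventually_fubini:
  "eventually P (fubini b F G) \<longleftrightarrow> eventually (\<lambda>t. eventually (\<lambda>s. P (b (s, t))) F) G"
  unfolding fubini_def
proof (rule eventually_Abs_filter, rule is_filter.intro)
  show "\<forall>\<^sub>F t in G. \<forall>\<^sub>F s in F. True" by simp
next
  fix P Q
  assume "\<forall>\<^sub>F t in G. \<forall>\<^sub>F s in F. P (b (s, t))" "\<forall>\<^sub>F t in G. \<forall>\<^sub>F s in F. Q (b (s, t))"
  then show "\<forall>\<^sub>F t in G. \<forall>\<^sub>F s in F. P (b (s, t)) \<and> Q (b (s, t))"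
    by eventually_elim (rule eventually_conj)
next
  fix P Q
  assume "\<forall>x. P x \<longrightarrow> Q x" "\<forall>\<^sub>F t in G. \<forall>\<^sub>F s in F. P (b (s, t))"
  from this(2) show "\<forall>\<^sub>F t in G. \<forall>\<^sub>F s in F. Q (b (s, t))"
    by eventually_elim (auto elim: eventually_mono simp: \<open>\<forall>x. P x \<longrightarrow> Q x\<close>)
qed

lemma ultrafilter_on_fubini:
  assumes b: "bij_betw b (S \<times> T) I" and F: "ultrafilter_on S F" and G: "ultrafilter_on T G"
  shows "ultrafilter_on I (fubini b F G)"
proof -
  have bI: "b (s, t) \<in> I" if "s \<in> S" "t \<in> T" for s t using b that by (auto simp: bij_betw_def)
  have not: "eventually (\<lambda>x. \<not> P x) (fubini b F G) \<longleftrightarrow> \<not> eventually P (fubini b F G)" for P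
    unfolding eventually_fubini ultrafilter_on_not[OF F] by (rule ultrafilter_on_not[OF G])
  have "\<not> eventually (\<lambda>x. False) (fubini b F G)" using not[of "\<lambda>x. True"] by simp
  then have "fubini b F G \<noteq> bot" by auto
  have I: "eventually (\<lambda>x. x \<in> I) (fubini b F G)"
    unfolding eventually_fubini using ultrafilter_on_carrier[OF G]
  proof eventually_elim
    case (elim t)
    show ?case using ultrafilter_on_carrier[OF F] by eventually_elim (rule bI[OF _ elim])
  qed
  have "X \<in> fsets I (fubini b F G) \<or> I - X \<in> fsets I (fubini b F G)" if X: "X \<subseteq> I" for X
  proof (cases "eventually (\<lambda>x. x \<in> X) (fubini b F G)")
    case True
    then show ?thesis using X unfolding fsets_def by blast
  next
    case False
    then have "eventually (\<lambda>x. x \<notin> X) (fubini b F G)" unfolding not .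
    then have "eventually (\<lambda>x. x \<in> I - X) (fubini b F G)" using I by eventually_elim blast
    then show ?thesis unfolding fsets_def by blast
  qed
  then show ?thesis using \<open>fubini b F G \<noteq> bot\<close> I unfolding ultrafilter_on_def le_principal by blast
qed

lemma regular_filter_fubini:
  assumes b: "bij_betw b (I \<times> T) I" and F: "ultrafilter_on I F" and G: "ultrafilter_on T G"
    and reg: "regular_filter I F"
  shows "regular_filter I (fubini b F G)"
proof -
  obtain R where R: "\<And>i. i \<in> I \<Longrightarrow> R i \<in> fsets I F" "\<And>t. t \<in> I \<Longrightarrow> finite {i \<in> I. t \<in> R i}"
    using reg unfolding regular_filter_def by blast
  let ?s = "\<lambda>x. fst (inv_into (I \<times> T) b x)"
  have s: "?s x \<in> I" if "x \<in> I" for x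
    using inv_into_into[of x b "I \<times> T"] b that by (auto simp: bij_betw_def mem_Times_iff)
  have sb: "?s (b (s, t)) = s" if "s \<in> I" "t \<in> T" for s t
    using bij_betw_inv_into_left[OF b, of "(s, t)"] that by simp
  show ?thesis
    unfolding regular_filter_def
  proof (intro exI conjI ballI)
    fix i assume i: "i \<in> I"
    show "{x \<in> I. ?s x \<in> R i} \<in> fsets I (fubini b F G)"
      unfolding fsets_Collect_iff[OF ultrafilter_on_fubini[OF b F G]] eventually_fubini
      using ultrafilter_on_carrier[OF G]
    proof eventually_elim
      case (elim t)
      have "eventually (\<lambda>s. s \<in> R i) F" using R(1)[OF i] unfolding fsets_def by blast
      with ultrafilter_on_carrier[OF F] show ?case by eventually_elim (simp add: sb elim)
    qed
  next
    fix x assume "x \<in> I"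
    then show "finite {i \<in> I. x \<in> {x \<in> I. ?s x \<in> R i}}" using R(2)[OF s] by simp
  qed
qed

text \<open>Countable completeness of the outer ultrafilter moves the quantifier over \<open>n\<close> inside, so that almost every section
of \<open>f\<close> satisfies the hypothesis of flexibility for \<open>F\<close>.\<close>

lemma (in complete_ultrafilter) flexible_fubini:
  fixes I :: "'i set"
  assumes b: "bij_betw b (I \<times> Field \<kappa>) I" and F: "ultrafilter_on I F" and flex: "flexible \<mu> I F"
  shows "flexible \<mu> I (fubini b F U)"
  unfolding flexible_def
proof (intro allI impI)
  fix f :: "'i \<Rightarrow> nat"
  let ?D = "fubini b F U"
  note uf = ultrafilter_on_fubini[OF b F ultrafilter]
  assume "\<forall>n. {x \<in> I. n < f x} \<in> fsets I ?D"
  then have f: "eventually (\<lambda>t. eventually (\<lambda>s. n < f (b (s, t))) F) U" for n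
    unfolding fsets_Collect_iff[OF uf] eventually_fubini by blast
  have large: "eventually (\<lambda>t. \<forall>n\<in>UNIV. eventually (\<lambda>s. n < f (b (s, t))) F) U"
    using f by (intro eventually_ball countable_less) auto
  define good_at where "good_at = (\<lambda>t. \<forall>n. eventually (\<lambda>s. n < f (b (s, t))) F)"
  define Q where "Q = (\<lambda>t X. (\<forall>\<alpha>\<in>Field \<mu>. X \<alpha> \<in> fsets I F) \<and>
      (\<forall>s\<in>I. finite {\<alpha> \<in> Field \<mu>. s \<in> X \<alpha>} \<and> card {\<alpha> \<in> Field \<mu>. s \<in> X \<alpha>} \<le> f (b (s, t))))"
  have "\<exists>X. Q t X" if "good_at t" for t
  proof -
    have "\<forall>n. {s \<in> I. n < f (b (s, t))} \<in> fsets I F"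
      unfolding fsets_Collect_iff[OF F] using that unfolding good_at_def .
    then show ?thesis
      unfolding Q_def by (rule mp[OF spec[OF flex[unfolded flexible_def], of "\<lambda>s. f (b (s, t))"]])
  qed
  then have "\<forall>t. \<exists>X. good_at t \<longrightarrow> Q t X" by blast
  from choice[OF this] obtain X where "\<forall>t. good_at t \<longrightarrow> Q t (X t)" ..
  then have Q: "Q t (X t)" if "good_at t" for t using that by blast
  have X: "X t \<alpha> \<in> fsets I F" if "good_at t" "\<alpha> \<in> Field \<mu>" for t \<alpha>
    using Q[OF that(1)] that(2) unfolding Q_def by simp
  have Xfin: "finite {\<alpha> \<in> Field \<mu>. s \<in> X t \<alpha>} \<and> card {\<alpha> \<in> Field \<mu>. s \<in> X t \<alpha>} \<le> f (b (s, t))"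
    if "good_at t" "s \<in> I" for t s
    using Q[OF that(1)] that(2) unfolding Q_def by simp
  let ?c = "inv_into (I \<times> Field \<kappa>) b"
  have c: "fst (?c x) \<in> I" "b (?c x) = x" if "x \<in> I" for x
    using inv_into_into[of x b "I \<times> Field \<kappa>"] b that bij_betw_inv_into_right[OF b]
    by (auto simp: bij_betw_def mem_Times_iff)
  have cb: "?c (b (s, t)) = (s, t)" if "s \<in> I" "t \<in> Field \<kappa>" for s t
    using bij_betw_inv_into_left[OF b, of "(s, t)"] that by simp
  let ?X = "\<lambda>\<alpha>. {x \<in> I. good_at (snd (?c x)) \<and> fst (?c x) \<in> X (snd (?c x)) \<alpha>}"
  have mem: "?X \<alpha> \<in> fsets I ?D" if \<alpha>: "\<alpha> \<in> Field \<mu>" for \<alpha>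
    unfolding fsets_Collect_iff[OF uf] eventually_fubini
    using ultrafilter_on_carrier[OF ultrafilter] large
  proof eventually_elim
    case (elim t)
    then have good: "good_at t" unfolding good_at_def by blast
    then have "eventually (\<lambda>s. s \<in> X t \<alpha>) F" using X[OF _ \<alpha>] unfolding fsets_def by blast
    with ultrafilter_on_carrier[OF F] show ?case
      by eventually_elim (simp add: cb elim(1) good)
  qed
  have fin: "finite {\<alpha> \<in> Field \<mu>. x \<in> ?X \<alpha>} \<and> card {\<alpha> \<in> Field \<mu>. x \<in> ?X \<alpha>} \<le> f x" if x: "x \<in> I" for x
  proof (cases "good_at (snd (?c x))")
    case True
    then have "{\<alpha> \<in> Field \<mu>. x \<in> ?X \<alpha>} = {\<alpha> \<in> Field \<mu>. fst (?c x) \<in> X (snd (?c x)) \<alpha>}" using x by blast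
    then show ?thesis using Xfin[OF True c(1)[OF x]] c(2)[OF x] by simp
  next
    case False
    then have "{\<alpha> \<in> Field \<mu>. x \<in> ?X \<alpha>} = {}" by blast
    then show ?thesis by (metis card.empty finite.emptyI zero_le)
  qed
  show "\<exists>X. (\<forall>\<alpha>\<in>Field \<mu>. X \<alpha> \<in> fsets I ?D) \<and>
      (\<forall>x\<in>I. finite {\<alpha> \<in> Field \<mu>. x \<in> X \<alpha>} \<and> card {\<alpha> \<in> Field \<mu>. x \<in> X \<alpha>} \<le> f x)"
    by (rule exI[of _ ?X]) (intro conjI ballI mem conjunct1[OF fin] conjunct2[OF fin])
qed

text \<open>In the tree of finite binary sequences, the functions \<open>node \<alpha>\<close> represent pairwise comparable
elements of the ultrapower by \<open>D\<close>. The second part says that a simultaneous choice of witnessing sets is impossible;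
an element of the ultrapower that determines a branch through all of them would give such a choice.\<close>

definition unbounded_branch :: "'i set \<Rightarrow> 'i filter \<Rightarrow> 'w set \<Rightarrow> ('w \<Rightarrow> 'i \<Rightarrow> bool list) \<Rightarrow> bool" where
  "unbounded_branch I D W node \<longleftrightarrow>
     (\<forall>\<alpha>\<in>W. \<forall>\<beta>\<in>W. eventually (\<lambda>x. \<not> node \<alpha> x \<parallel> node \<beta> x) D) \<and>
     (\<forall>X. (\<forall>\<alpha>\<in>W. X \<alpha> \<in> fsets I D) \<longrightarrow> (\<exists>\<alpha>\<in>W. \<exists>\<beta>\<in>W. \<exists>x\<in>X \<alpha> \<inter> X \<beta>. node \<alpha> x \<parallel> node \<beta> x))"

text \<open>The pairs \<open>(\<alpha>, t)\<close> index part of the regular family of \<open>F\<close>, via \<open>b\<close>. At \<open>(s, t)\<close> the finite set of active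
\<open>\<alpha>\<close> is embedded into the binary sequences by \<open>forest_embedding\<close>. Sets in \<open>D\<close> on which all nodes
are comparable project to sets \<open>Y \<alpha>\<close> in \<open>U\<close>: if \<open>t \<in> Y \<alpha> \<inter> Y \<beta>\<close>, then \<open>F\<close>-many \<open>s\<close> have both
\<open>\<alpha>\<close> and \<open>\<beta>\<close> active, and a single such \<open>s\<close> shows that \<open>u \<alpha> t\<close> and \<open>u \<beta> t\<close> cohere.\<close>

lemma (in complete_ultrafilter) unbounded_branch_fubini:
  fixes \<mu> :: "'i rel"
  assumes \<mu>: "Card_order \<mu>" and less: "\<kappa> <o \<mu>"
    and b: "bij_betw b (Field \<mu> \<times> Field \<kappa>) (Field \<mu>)"
    and F: "ultrafilter_on (Field \<mu>) F" and reg: "regular_filter (Field \<mu>) F"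
  shows "\<exists>W node. W \<subseteq> Field \<mu> \<and> unbounded_branch (Field \<mu>) (fubini b F U) W node"
proof -
  let ?I = "Field \<mu>" and ?K = "Field \<kappa>"
  have wo: "Well_order \<mu>" using \<mu> unfolding card_order_on_def by blast
  obtain R where R: "\<And>i. i \<in> ?I \<Longrightarrow> eventually (\<lambda>s. s \<in> R i) F" "\<And>s. s \<in> ?I \<Longrightarrow> finite {i \<in> ?I. s \<in> R i}"
    using reg unfolding regular_filter_def fsets_def by blast
  obtain W and u :: "'i \<Rightarrow> 'k \<Rightarrow> 'i set" where W: "W \<subseteq> ?I"
    and u: "\<And>\<alpha> t. u \<alpha> t \<subseteq> underS \<mu> \<alpha>"
    and coh: "\<And>\<alpha> \<beta>. \<alpha> \<in> W \<Longrightarrow> \<beta> \<in> W \<Longrightarrow> \<beta> \<in> underS \<mu> \<alpha> \<Longrightarrow>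
           eventually (\<lambda>t. u \<alpha> t \<inter> underS \<mu> \<beta> = u \<beta> t) U"
    and unb: "\<forall>Y. (\<forall>\<alpha>\<in>W. eventually (\<lambda>t. t \<in> Y \<alpha>) U) \<longrightarrow>
           (\<exists>t\<in>?K. \<exists>\<alpha>\<in>W. \<exists>\<beta>\<in>W. t \<in> Y \<alpha> \<inter> Y \<beta> \<and> \<beta> \<in> underS \<mu> \<alpha> \<and> u \<alpha> t \<inter> underS \<mu> \<beta> \<noteq> u \<beta> t)"
    by (rule coherent_family[OF \<mu> less]) (rule that)
  have bI: "b (s, t) \<in> ?I" if "s \<in> ?I" "t \<in> ?K" for s t using b that by (auto simp: bij_betw_def)
  let ?c = "inv_into (?I \<times> ?K) b"
  have cb: "?c (b (s, t)) = (s, t)" if "s \<in> ?I" "t \<in> ?K" for s t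
    using bij_betw_inv_into_left[OF b, of "(s, t)"] that by simp
  define A where "A = (\<lambda>s t. {\<alpha> \<in> W. s \<in> R (b (\<alpha>, t))})"
  have finA: "finite (A s t)" if "s \<in> ?I" "t \<in> ?K" for s t
  proof -
    have "inj_on (\<lambda>\<alpha>. b (\<alpha>, t)) (A s t)"
      using b W that(2) unfolding bij_betw_def A_def inj_on_def by blast
    moreover have "(\<lambda>\<alpha>. b (\<alpha>, t)) ` A s t \<subseteq> {i \<in> ?I. s \<in> R i}"
      unfolding A_def using W bI[OF _ that(2)] by blast
    then have "finite ((\<lambda>\<alpha>. b (\<alpha>, t)) ` A s t)" by (rule finite_subset[OF _ R(2)[OF that(1)]])
    ultimately show ?thesis by (rule finite_imageD[rotated])
  qed
  have "\<exists>e :: 'i \<Rightarrow> bool list. \<forall>\<alpha>\<in>A s t. \<forall>\<beta>\<in>A s t. \<beta> \<in> underS \<mu> \<alpha> \<longrightarrow>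
      (e \<alpha> \<parallel> e \<beta> \<longleftrightarrow> u \<alpha> t \<inter> underS \<mu> \<beta> \<noteq> u \<beta> t)" if "s \<in> ?I" "t \<in> ?K" for s t
    using forest_embedding[OF wo finA[OF that], of "\<lambda>\<alpha>. u \<alpha> t"] u by blast
  then obtain e :: "'i \<Rightarrow> 'k \<Rightarrow> 'i \<Rightarrow> bool list" where
    e: "\<And>s t \<alpha> \<beta>. s \<in> ?I \<Longrightarrow> t \<in> ?K \<Longrightarrow> \<alpha> \<in> A s t \<Longrightarrow> \<beta> \<in> A s t \<Longrightarrow> \<beta> \<in> underS \<mu> \<alpha> \<Longrightarrow>
      e s t \<alpha> \<parallel> e s t \<beta> \<longleftrightarrow> u \<alpha> t \<inter> underS \<mu> \<beta> \<noteq> u \<beta> t" by metis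
  define node where "node = (\<lambda>\<alpha> x. e (fst (?c x)) (snd (?c x)) \<alpha>)"
  have node: "node \<alpha> (b (s, t)) = e s t \<alpha>" if "s \<in> ?I" "t \<in> ?K" for s t \<alpha>
    unfolding node_def cb[OF that] by simp
  have evA: "eventually (\<lambda>s. s \<in> ?I \<and> \<alpha> \<in> A s t) F" if "\<alpha> \<in> W" "t \<in> ?K" for \<alpha> t
  proof -
    have "b (\<alpha>, t) \<in> ?I" using bI that W by blast
    from R(1)[OF this] ultrafilter_on_carrier[OF F] show ?thesis
      by eventually_elim (simp add: A_def that(1))
  qed
  have below: "eventually (\<lambda>x. \<not> node \<alpha> x \<parallel> node \<beta> x) (fubini b F U)"
    if \<alpha>: "\<alpha> \<in> W" and \<beta>: "\<beta> \<in> W" and \<beta>\<alpha>: "\<beta> \<in> underS \<mu> \<alpha>" for \<alpha> \<beta>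
    unfolding eventually_fubini using coh[OF that] ultrafilter_on_carrier[OF ultrafilter]
  proof eventually_elim
    case (elim t)
    show ?case
      using evA[OF \<alpha> elim(2)] evA[OF \<beta> elim(2)]
      by eventually_elim (use elim e[OF _ elim(2) _ _ \<beta>\<alpha>] node[OF _ elim(2)] in auto)
  qed
  have "eventually (\<lambda>x. \<not> node \<alpha> x \<parallel> node \<beta> x) (fubini b F U)"
    if \<alpha>\<beta>: "\<alpha> \<in> W" "\<beta> \<in> W" for \<alpha> \<beta>
  proof -
    consider "\<alpha> = \<beta>" | "\<beta> \<in> underS \<mu> \<alpha>" | "\<alpha> \<in> underS \<mu> \<beta>"
      using underS_total[OF wo, of \<alpha> \<beta>] \<alpha>\<beta> W by blast
    then show ?thesis
    proof cases
      case 1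
      then show ?thesis by (simp add: parallel_def)
    next
      case 2
      then show ?thesis using below \<alpha>\<beta> by blast
    next
      case 3
      then show ?thesis using below[OF \<alpha>\<beta>(2,1)] by (simp add: parallel_commute)
    qed
  qed
  moreover have "\<exists>\<alpha>\<in>W. \<exists>\<beta>\<in>W. \<exists>x\<in>X \<alpha> \<inter> X \<beta>. node \<alpha> x \<parallel> node \<beta> x"
    if X: "\<forall>\<alpha>\<in>W. X \<alpha> \<in> fsets ?I (fubini b F U)" for X
  proof -
    define Y where "Y = (\<lambda>\<alpha>. {t. eventually (\<lambda>s. (s \<in> ?I \<and> \<alpha> \<in> A s t) \<and> b (s, t) \<in> X \<alpha>) F})"
    have "eventually (\<lambda>t. t \<in> Y \<alpha>) U" if \<alpha>: "\<alpha> \<in> W" for \<alpha>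
    proof -
      have "eventually (\<lambda>t. eventually (\<lambda>s. b (s, t) \<in> X \<alpha>) F) U"
        using X \<alpha> unfolding fsets_def eventually_fubini by blast
      with ultrafilter_on_carrier[OF ultrafilter] show ?thesis
        unfolding Y_def mem_Collect_eq
      proof eventually_elim
        case (elim t)
        show ?case using evA[OF \<alpha> elim(1)] elim(2) by eventually_elim blast
      qed
    qed
    then obtain t \<alpha> \<beta> where t: "t \<in> ?K" "\<alpha> \<in> W" "\<beta> \<in> W" "t \<in> Y \<alpha>" "t \<in> Y \<beta>" "\<beta> \<in> underS \<mu> \<alpha>"
        "u \<alpha> t \<inter> underS \<mu> \<beta> \<noteq> u \<beta> t"
      using spec[OF unb, of Y] by blast
    have "eventually (\<lambda>s. (s \<in> ?I \<and> \<alpha> \<in> A s t \<and> b (s, t) \<in> X \<alpha>) \<and> (\<beta> \<in> A s t \<and> b (s, t) \<in> X \<beta>)) F"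
      using t(4,5) unfolding Y_def mem_Collect_eq by eventually_elim blast
    then obtain s where s: "s \<in> ?I" "\<alpha> \<in> A s t" "b (s, t) \<in> X \<alpha>" "\<beta> \<in> A s t" "b (s, t) \<in> X \<beta>"
      using ultrafilter_on_ex[OF F] by blast
    then have "node \<alpha> (b (s, t)) \<parallel> node \<beta> (b (s, t))"
      using e[OF s(1) t(1) s(2,4) t(6)] t(7) node[OF s(1) t(1)] by simp
    then show ?thesis using s t by blast
  qed
  ultimately show ?thesis using W unfolding unbounded_branch_def by blast
qed

text \<open>Multiplicativity gives \<open>g {\<alpha>} \<inter> g {\<beta>} = g {\<alpha>, \<beta>}\<close>, so the sets \<open>g {\<alpha>}\<close> would bound the branch.\<close>

lemma not_good_unbounded_branch:
  assumes D: "ultrafilter_on I D" and W: "W \<subseteq> I" and br: "unbounded_branch I D W node"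
  shows "\<not> good I D"
proof
  assume "good I D"
  let ?f = "\<lambda>u. {x \<in> I. \<forall>\<alpha>\<in>u \<inter> W. \<forall>\<beta>\<in>u \<inter> W. \<not> node \<alpha> x \<parallel> node \<beta> x}"
  have "?f u \<in> fsets I D" if "u \<in> Fpow I" for u
  proof -
    have "finite (u \<inter> W)" using that unfolding Fpow_def by blast
    then show ?thesis
      unfolding fsets_Collect_iff[OF D]
      using br unfolding unbounded_branch_def by (intro eventually_ball_finite ballI) auto
  qed
  then have "?f \<in> Fpow I \<rightarrow> fsets I D" by blast
  from mp[OF spec[OF \<open>good I D\<close>[unfolded good_def succ_good_def Field_card_of]] this]
  obtain g where g: "g \<in> Fpow I \<rightarrow> fsets I D" "\<forall>u\<in>Fpow I. g u \<subseteq> ?f u"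
      "\<forall>u\<in>Fpow I. \<forall>v\<in>Fpow I. g u \<inter> g v = g (u \<union> v)"
    by (elim exE conjE) (rule that)
  have sing: "{\<alpha>} \<in> Fpow I" if "\<alpha> \<in> W" for \<alpha> using that W unfolding Fpow_def by auto
  then have "\<forall>\<alpha>\<in>W. g {\<alpha>} \<in> fsets I D" using g(1) by blast
  then obtain \<alpha> \<beta> x where x: "\<alpha> \<in> W" "\<beta> \<in> W" "x \<in> g {\<alpha>} \<inter> g {\<beta>}" "node \<alpha> x \<parallel> node \<beta> x"
    using br unfolding unbounded_branch_def by meson
  have "{\<alpha>, \<beta>} \<in> Fpow I" using x W unfolding Fpow_def by auto
  moreover have "g {\<alpha>} \<inter> g {\<beta>} = g {\<alpha>, \<beta>}" using g(3) sing x(1,2) by (metis insert_is_Un)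
  ultimately have "x \<in> ?f {\<alpha>, \<beta>}" using g(2) x(3) by blast
  then show False using x by blast
qed

section \<open>Satisfaction in ultrapowers\<close>

instance tm :: countable by countable_datatype
instance fm :: countable by countable_datatype

lemma tm_val_cong: "(\<And>x. x \<in> vars_tm \<tau> \<Longrightarrow> e x = e' x) \<Longrightarrow> tm_val M e \<tau> = tm_val M e' \<tau>"
proof (induction \<tau>)
  case (Fn F ts)
  then have "map (tm_val M e) ts = map (tm_val M e') ts" by (intro map_cong) auto
  then show ?case by (simp del: map_eq_conv)
qed simp

lemma sat_cong: "(\<And>x. x \<in> free_vars \<phi> \<Longrightarrow> e x = e' x) \<Longrightarrow> sat M e \<phi> \<longleftrightarrow> sat M e' \<phi>"
proof (induction \<phi> arbitrary: e e')
  case (Eq s t)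
  then show ?case using tm_val_cong[of s e e' M] tm_val_cong[of t e e' M] by simp
next
  case (Rel R ts)
  then have "map (tm_val M e) ts = map (tm_val M e') ts" by (intro map_cong tm_val_cong) auto
  then show ?case by (simp del: map_eq_conv)
next
  case (Neg \<phi>)
  have "sat M e \<phi> \<longleftrightarrow> sat M e' \<phi>" using Neg.prems by (intro Neg.IH) simp
  then show ?case by simp
next
  case (Conj \<phi> \<psi>)
  have "sat M e \<phi> \<longleftrightarrow> sat M e' \<phi>" "sat M e \<psi> \<longleftrightarrow> sat M e' \<psi>"
    using Conj.prems by (intro Conj.IH; simp)+
  then show ?case by simp
next
  case (Exists x \<phi>)
  have "sat M (e(x := a)) \<phi> \<longleftrightarrow> sat M (e'(x := a)) \<phi>" for a
    using Exists.prems by (intro Exists.IH) simp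
  then show ?case by simp
qed

lemma finite_vars_tm: "finite (vars_tm \<tau>)"
  by (induction \<tau>) auto

lemma finite_free_vars: "finite (free_vars \<phi>)"
  by (induction \<phi>) (auto simp: finite_vars_tm)

lemma tm_val_in_univ:
  assumes "is_struct L M"
  shows "wf_tm L \<tau> \<Longrightarrow> (\<And>x. x \<in> vars_tm \<tau> \<Longrightarrow> e x \<in> univ M) \<Longrightarrow> tm_val M e \<tau> \<in> univ M"
proof (induction \<tau>)
  case (Fn F ts)
  have "set (map (tm_val M e) ts) \<subseteq> univ M" using Fn by auto
  moreover have "fun_ar L F = Some (length (map (tm_val M e) ts))" using Fn.prems by simp
  ultimately show ?case using assms unfolding is_struct_def tm_val.simps by blast
qed simp

locale ultrapower_struct =
  fixes I :: "'i set" and D :: "'i filter" and L :: language and M :: "'a struct"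
  assumes uf: "ultrafilter_on I D" and struct: "is_struct L M"
begin

abbreviation G :: "('i \<Rightarrow> 'a) set" where "G \<equiv> I \<rightarrow>\<^sub>E univ M"

definition cls :: "('i \<Rightarrow> 'a) \<Rightarrow> ('i \<Rightarrow> 'a) set" where "cls h = ae_equal I D M `` {h}"

abbreviation U :: "('i \<Rightarrow> 'a) set struct" where "U \<equiv> ultrapower I D M"

lemma mem_cls_iff: "h \<in> G \<Longrightarrow> g \<in> cls h \<longleftrightarrow> g \<in> G \<and> eventually (\<lambda>t. h t = g t) D"
  unfolding cls_def ae_equal_def by simp

lemma equiv_ae_equal: "equiv G (ae_equal I D M)"
proof (rule equivI)
  show "ae_equal I D M \<subseteq> G \<times> G" unfolding ae_equal_def by blast
  show "refl_on G (ae_equal I D M)" unfolding refl_on_def ae_equal_def by auto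
  show "sym (ae_equal I D M)"
    unfolding sym_def ae_equal_def by (auto elim: eventually_mono)
  show "trans (ae_equal I D M)"
    unfolding trans_def ae_equal_def by (auto elim: eventually_elim2)
qed

lemma cls_eq_iff: "h \<in> G \<Longrightarrow> g \<in> G \<Longrightarrow> cls h = cls g \<longleftrightarrow> eventually (\<lambda>t. h t = g t) D"
  unfolding cls_def eq_equiv_class_iff[OF equiv_ae_equal] unfolding ae_equal_def by simp

lemma univ_U: "univ U = cls ` G"
  unfolding ultrapower_def quotient_def cls_def by auto

lemma representatives:
  fixes E :: "'n \<Rightarrow> ('i \<Rightarrow> 'a) set"
  assumes "\<And>y. E y \<in> univ U"
  obtains e where "\<And>y. e y \<in> G" "E = (\<lambda>y. cls (e y))"
proof -
  have "\<forall>y. \<exists>h. h \<in> G \<and> E y = cls h" using assms unfolding univ_U by blast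
  from choice[OF this] show thesis using that by blast
qed

lemma list_all2_mem_cls:
  assumes "list_all2 (\<in>) hs (map cls es)" "set es \<subseteq> G"
  shows "eventually (\<lambda>t. map (\<lambda>h. h t) hs = map (\<lambda>h. h t) es) D"
  using assms
proof (induction es arbitrary: hs)
  case (Cons h es)
  then obtain g gs where hs: "hs = g # gs" "g \<in> cls h" "list_all2 (\<in>) gs (map cls es)"
    by (auto simp: list_all2_Cons2)
  then have "eventually (\<lambda>t. map (\<lambda>h. h t) gs = map (\<lambda>h. h t) es) D" using Cons by simp
  moreover have "eventually (\<lambda>t. h t = g t) D" using hs(2) Cons.prems mem_cls_iff by simp
  ultimately show ?case unfolding hs(1) by eventually_elim simp
qed simp

lemma list_all2_cls_self: "set es \<subseteq> G \<Longrightarrow> list_all2 (\<in>) es (map cls es)"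
  by (induction es) (auto simp: mem_cls_iff)

lemma rel_in_U:
  assumes "set es \<subseteq> G"
  shows "rel_in U R (map cls es) \<longleftrightarrow> eventually (\<lambda>t. rel_in M R (map (\<lambda>h. h t) es)) D"
proof
  assume "rel_in U R (map cls es)"
  then obtain hs where hs: "list_all2 (\<in>) hs (map cls es)"
      "eventually (\<lambda>t. rel_in M R (map (\<lambda>h. h t) hs)) D"
    unfolding ultrapower_def by auto
  from list_all2_mem_cls[OF hs(1) assms] hs(2)
  show "eventually (\<lambda>t. rel_in M R (map (\<lambda>h. h t) es)) D" by eventually_elim simp
next
  assume "eventually (\<lambda>t. rel_in M R (map (\<lambda>h. h t) es)) D"
  then show "rel_in U R (map cls es)"
    unfolding ultrapower_def using list_all2_cls_self[OF assms] by auto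
qed

lemma fun_in_U:
  assumes es: "set es \<subseteq> G" and ar: "fun_ar L F = Some (length es)"
  shows "fun_in U F (map cls es) = cls (\<lambda>t\<in>I. fun_in M F (map (\<lambda>h. h t) es))"
    and "(\<lambda>t\<in>I. fun_in M F (map (\<lambda>h. h t) es)) \<in> G"
proof -
  let ?v = "\<lambda>t\<in>I. fun_in M F (map (\<lambda>h. h t) es)"
  have "fun_in M F (map (\<lambda>h. h t) es) \<in> univ M" if "t \<in> I" for t
  proof -
    have "set (map (\<lambda>h. h t) es) \<subseteq> univ M" using es that by (auto simp: PiE_iff)
    moreover have "fun_ar L F = Some (length (map (\<lambda>h. h t) es))" using ar by simp
    ultimately show ?thesis using struct unfolding is_struct_def by blast
  qed
  then show vG: "?v \<in> G" by auto
  have v: "eventually (\<lambda>t. ?v t = fun_in M F (map (\<lambda>h. h t) es)) D"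
    using ultrafilter_on_carrier[OF uf] by eventually_elim simp
  have "g \<in> fun_in U F (map cls es) \<longleftrightarrow> g \<in> cls ?v" for g
  proof
    assume "g \<in> fun_in U F (map cls es)"
    then obtain hs where hs: "g \<in> G" "list_all2 (\<in>) hs (map cls es)"
        "eventually (\<lambda>t. g t = fun_in M F (map (\<lambda>h. h t) hs)) D"
      unfolding ultrapower_def by auto
    from list_all2_mem_cls[OF hs(2) es] hs(3) v
    have "eventually (\<lambda>t. ?v t = g t) D" by eventually_elim simp
    then show "g \<in> cls ?v" using hs(1) mem_cls_iff[OF vG] by blast
  next
    assume "g \<in> cls ?v"
    then have g: "g \<in> G" "eventually (\<lambda>t. ?v t = g t) D" using mem_cls_iff[OF vG] by auto
    from g(2) v have "eventually (\<lambda>t. g t = fun_in M F (map (\<lambda>h. h t) es)) D"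
      by eventually_elim simp
    then show "g \<in> fun_in U F (map cls es)"
      unfolding ultrapower_def using list_all2_cls_self[OF es] g(1) by auto
  qed
  then show "fun_in U F (map cls es) = cls ?v" by blast
qed

lemma tm_val_U:
  assumes e: "\<And>x. e x \<in> G"
  shows "wf_tm L \<tau> \<Longrightarrow> (\<lambda>t\<in>I. tm_val M (\<lambda>x. e x t) \<tau>) \<in> G \<and>
     tm_val U (\<lambda>x. cls (e x)) \<tau> = cls (\<lambda>t\<in>I. tm_val M (\<lambda>x. e x t) \<tau>)"
proof (induction \<tau>)
  case (Var x)
  have "(\<lambda>t\<in>I. e x t) = e x" using e[of x] by (simp add: PiE_restrict)
  then show ?case using e[of x] by simp
next
  case (Fn F ts)
  let ?v = "\<lambda>\<tau>. \<lambda>t\<in>I. tm_val M (\<lambda>x. e x t) \<tau>"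
  have IH: "?v \<tau> \<in> G" "tm_val U (\<lambda>x. cls (e x)) \<tau> = cls (?v \<tau>)" if "\<tau> \<in> set ts" for \<tau>
  proof -
    have wf: "wf_tm L \<tau>" using Fn.prems that by simp
    show "?v \<tau> \<in> G" "tm_val U (\<lambda>x. cls (e x)) \<tau> = cls (?v \<tau>)"
      using Fn.IH[OF that wf] by blast+
  qed
  have m: "map (tm_val U (\<lambda>x. cls (e x))) ts = map cls (map ?v ts)" using IH(2) by simp
  have es: "set (map ?v ts) \<subseteq> G" unfolding set_map using IH(1) by blast
  have ar: "fun_ar L F = Some (length (map ?v ts))" using Fn.prems by simp
  have v: "(\<lambda>t\<in>I. fun_in M F (map (\<lambda>h. h t) (map ?v ts))) = ?v (Fn F ts)"
    by (rule restrict_ext) (simp add: comp_def)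
  have "tm_val U (\<lambda>x. cls (e x)) (Fn F ts) = cls (?v (Fn F ts))"
    using fun_in_U(1)[OF es ar] unfolding v tm_val.simps(2)[of U] m .
  then show ?case using fun_in_U(2)[OF es ar] unfolding v by blast
qed

theorem Los:
  assumes "\<And>x. e x \<in> G" "wf_fm L \<phi>"
  shows "sat U (\<lambda>x. cls (e x)) \<phi> \<longleftrightarrow> eventually (\<lambda>t. sat M (\<lambda>x. e x t) \<phi>) D"
  using assms
proof (induction \<phi> arbitrary: e)
  case (Eq \<sigma> \<tau>)
  let ?v = "\<lambda>\<tau>. \<lambda>t\<in>I. tm_val M (\<lambda>x. e x t) \<tau>"
  have *: "?v \<sigma> \<in> G" "?v \<tau> \<in> G" "tm_val U (\<lambda>x. cls (e x)) \<sigma> = cls (?v \<sigma>)"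
      "tm_val U (\<lambda>x. cls (e x)) \<tau> = cls (?v \<tau>)"
    using tm_val_U[where e = e, OF Eq.prems(1), of \<sigma>] tm_val_U[where e = e, OF Eq.prems(1), of \<tau>] Eq.prems(2)
    unfolding wf_fm.simps by blast+
  have "eventually (\<lambda>t. (?v \<sigma> t = ?v \<tau> t) = sat M (\<lambda>x. e x t) (Eq \<sigma> \<tau>)) D"
    using ultrafilter_on_carrier[OF uf] by eventually_elim simp
  then show ?case unfolding sat.simps * cls_eq_iff[OF *(1,2)] by (rule eventually_subst)
next
  case (Rel R ts)
  let ?v = "\<lambda>\<tau>. \<lambda>t\<in>I. tm_val M (\<lambda>x. e x t) \<tau>"
  have *: "?v \<tau> \<in> G \<and> tm_val U (\<lambda>x. cls (e x)) \<tau> = cls (?v \<tau>)" if "\<tau> \<in> set ts" for \<tau>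
    using tm_val_U[where e = e, OF Rel.prems(1), of \<tau>] Rel.prems(2) that unfolding wf_fm.simps by blast
  then have m: "map (tm_val U (\<lambda>x. cls (e x))) ts = map cls (map ?v ts)" by simp
  have es: "set (map ?v ts) \<subseteq> G" unfolding set_map using * by blast
  have "sat U (\<lambda>x. cls (e x)) (Rel R ts) \<longleftrightarrow>
      eventually (\<lambda>t. rel_in M R (map (\<lambda>h. h t) (map ?v ts))) D"
    unfolding sat.simps m by (rule rel_in_U[OF es])
  moreover have "eventually (\<lambda>t. rel_in M R (map (\<lambda>h. h t) (map ?v ts)) = sat M (\<lambda>x. e x t) (Rel R ts)) D"
    using ultrafilter_on_carrier[OF uf] by eventually_elim (simp add: comp_def)
  ultimately show ?case using eventually_subst by simp
next
  case (Neg \<phi>)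
  then show ?case by (simp add: ultrafilter_on_not[OF uf])
next
  case (Conj \<phi> \<psi>)
  then show ?case by (simp add: eventually_conj_iff)
next
  case (Exists x \<phi>)
  have upd: "(\<lambda>y. cls (e y))(x := cls h) = (\<lambda>y. cls ((e(x := h)) y))" for h by (rule ext) simp
  have updM: "(\<lambda>y. (e(x := h)) y t) = (\<lambda>y. e y t)(x := h t)" for h t by (rule ext) simp
  have IH: "sat U ((\<lambda>y. cls (e y))(x := cls h)) \<phi> \<longleftrightarrow>
      eventually (\<lambda>t. sat M ((\<lambda>y. e y t)(x := h t)) \<phi>) D" if h: "h \<in> G" for h
    using Exists.IH[of "e(x := h)"] Exists.prems h unfolding upd updM by simp
  show ?case
  proof
    assume "sat U (\<lambda>y. cls (e y)) (Exists x \<phi>)"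
    then obtain h where h: "h \<in> G" "sat U ((\<lambda>y. cls (e y))(x := cls h)) \<phi>" unfolding sat.simps univ_U by blast
    then have "eventually (\<lambda>t. sat M ((\<lambda>y. e y t)(x := h t)) \<phi>) D" using IH by blast
    with ultrafilter_on_carrier[OF uf] show "eventually (\<lambda>t. sat M (\<lambda>y. e y t) (Exists x \<phi>)) D"
    proof eventually_elim
      case (elim t)
      then have "h t \<in> univ M" using h(1) by (auto simp: PiE_iff)
      then show ?case using elim by auto
    qed
  next
    assume ev: "eventually (\<lambda>t. sat M (\<lambda>y. e y t) (Exists x \<phi>)) D"
    obtain c where c: "c \<in> univ M" using struct unfolding is_struct_def by blast
    define h where "h = (\<lambda>t\<in>I. if sat M (\<lambda>y. e y t) (Exists x \<phi>)
        then SOME a. a \<in> univ M \<and> sat M ((\<lambda>y. e y t)(x := a)) \<phi> else c)"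
    have some: "(SOME a. a \<in> univ M \<and> sat M ((\<lambda>y. e y t)(x := a)) \<phi>) \<in> univ M \<and>
        sat M ((\<lambda>y. e y t)(x := (SOME a. a \<in> univ M \<and> sat M ((\<lambda>y. e y t)(x := a)) \<phi>))) \<phi>"
      if "sat M (\<lambda>y. e y t) (Exists x \<phi>)" for t
      by (rule someI_ex[where P = "\<lambda>a. a \<in> univ M \<and> sat M ((\<lambda>y. e y t)(x := a)) \<phi>"]) (use that in auto)
    have h: "h \<in> G" unfolding h_def using some c by auto
    have "eventually (\<lambda>t. sat M ((\<lambda>y. e y t)(x := h t)) \<phi>) D"
      using ev ultrafilter_on_carrier[OF uf] by eventually_elim (use some in \<open>simp add: h_def\<close>)
    then have "sat U ((\<lambda>y. cls (e y))(x := cls h)) \<phi>" using IH[OF h] by blast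
    then show "sat U (\<lambda>y. cls (e y)) (Exists x \<phi>)" using h unfolding sat.simps univ_U by blast
  qed
qed

lemma Los_inst:
  assumes "\<And>y. e y \<in> G" "h \<in> G" "wf_fm L \<phi>"
  shows "sat U ((\<lambda>y. cls (e y))(0 := cls h)) \<phi> \<longleftrightarrow>
     eventually (\<lambda>t. sat M ((\<lambda>y. e y t)(0 := h t)) \<phi>) D"
proof -
  have "(\<lambda>y. cls (e y))(0 := cls h) = (\<lambda>y. cls ((e(0 := h)) y))" by (rule ext) simp
  moreover have "(\<lambda>y. (e(0 := h)) y t) = (\<lambda>y. e y t)(0 := h t)" for t by (rule ext) simp
  ultimately show ?thesis using Los[of "e(0 := h)" \<phi>] assms by simp
qed

lemma G_nonempty: "G \<noteq> {}"
  using struct unfolding is_struct_def by (simp add: PiE_eq_empty_iff)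

lemma is_struct_U: "is_struct L U"
  unfolding is_struct_def
proof (intro conjI allI impI)
  show "univ U \<noteq> {}" using G_nonempty unfolding univ_U by blast
  fix F as assume F: "fun_ar L F = Some (length as) \<and> set as \<subseteq> univ U"
  then have "as \<in> lists (cls ` G)" unfolding univ_U by auto
  then obtain es where as: "as = map cls es" "es \<in> lists G" unfolding lists_image by auto
  then have es: "set es \<subseteq> G" by auto
  have "fun_ar L F = Some (length es)" using F as(1) by simp
  from fun_in_U[OF es this] show "fun_in U F as \<in> univ U" unfolding univ_U as(1) by blast
qed

lemma is_model_U:
  assumes T: "T \<subseteq> sentences L" and M: "is_model L T M"
  shows "is_model L T U"
  unfolding is_model_def
proof (intro conjI ballI is_struct_U)
  fix \<phi> assume \<phi>: "\<phi> \<in> T"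
  show "true_in U \<phi>"
    unfolding true_in_def
  proof (intro allI impI)
    fix E :: "nat \<Rightarrow> ('i \<Rightarrow> 'a) set" assume E: "range E \<subseteq> univ U"
    obtain e where e: "\<And>y. e y \<in> G" "E = (\<lambda>y. cls (e y))"
      by (rule representatives[of E]) (use E that in auto)
    have "eventually (\<lambda>t. sat M (\<lambda>y. e y t) \<phi>) D"
      using ultrafilter_on_carrier[OF uf]
    proof eventually_elim
      case (elim t)
      have "range (\<lambda>y. e y t) \<subseteq> univ M" using e(1) elim by (auto simp: PiE_iff)
      then show ?case using M \<phi> unfolding is_model_def true_in_def by blast
    qed
    moreover have "wf_fm L \<phi>" using T \<phi> unfolding sentences_def by blast
    ultimately show "sat U E \<phi>" using Los[where e = e, OF e(1)] unfolding e(2) by blast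
  qed
qed

end

section \<open>Countable saturation\<close>

lemma countably_incomplete_of_regular:
  assumes "infinite I" "regular_filter I D"
  shows "\<exists>Z :: nat \<Rightarrow> 'i set. (\<forall>n. eventually (\<lambda>t. t \<in> Z n) D) \<and> (\<forall>t\<in>I. \<exists>n. t \<notin> Z n)"
proof -
  obtain R where R: "\<And>i. i \<in> I \<Longrightarrow> eventually (\<lambda>t. t \<in> R i) D" "\<And>t. t \<in> I \<Longrightarrow> finite {i \<in> I. t \<in> R i}"
    using assms(2) unfolding regular_filter_def fsets_def by blast
  obtain j :: "nat \<Rightarrow> 'i" where j: "inj j" "range j \<subseteq> I"
    using infinite_countable_subset[OF assms(1)] by blast
  have "\<exists>n. t \<notin> R (j n)" if t: "t \<in> I" for t
  proof (rule ccontr)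
    assume "\<not> ?thesis"
    then have "range j \<subseteq> {i \<in> I. t \<in> R i}" using j(2) by blast
    then have "finite (range j)" using R(2)[OF t] by (rule finite_subset)
    then show False using range_inj_infinite[OF j(1)] by blast
  qed
  moreover have "eventually (\<lambda>t. t \<in> R (j n)) D" for n using R(1) j(2) by blast
  ultimately show ?thesis by (intro exI[of _ "\<lambda>n. R (j n)"]) blast
qed

text \<open>A type may contain uncountably many assignments that differ only at variables that do not matter. Resetting those
values makes a type over a countable set of parameters countable.\<close>

definition normal_inst :: "'a \<Rightarrow> 'a inst \<Rightarrow> 'a inst" where
  "normal_inst c = (\<lambda>(\<phi>, e). (\<phi>, \<lambda>y. if y \<in> free_vars \<phi> - {0} then e y else c))"

lemma realizes_normal_inst: "realizes M b (normal_inst c ` p) \<longleftrightarrow> realizes M b p"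
proof -
  have "sat M ((snd (normal_inst c (\<phi>, e)))(0 := b)) \<phi> \<longleftrightarrow> sat M (e(0 := b)) \<phi>" for \<phi> e
    unfolding normal_inst_def by (rule sat_cong) simp
  then show ?thesis unfolding realizes_def normal_inst_def by (auto split: prod.splits)
qed

lemma countable_normal_insts:
  assumes A: "countable A" and p: "\<And>\<phi> e y. (\<phi>, e) \<in> p \<Longrightarrow> y \<in> free_vars \<phi> - {0} \<Longrightarrow> e y \<in> A"
  shows "countable (normal_inst c ` p)"
proof -
  let ?h = "\<lambda>(\<phi>, l). (\<phi>, \<lambda>y. if y \<in> free_vars \<phi> - {0} then l ! y else c)"
  have "normal_inst c ` p \<subseteq> ?h ` (UNIV \<times> lists (insert c A))"
  proof
    fix x assume "x \<in> normal_inst c ` p"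
    then obtain \<phi> e where x: "(\<phi>, e) \<in> p" "x = normal_inst c (\<phi>, e)" by auto
    define N where "N = Suc (Max (insert 0 (free_vars \<phi>)))"
    have N: "y < N" if "y \<in> free_vars \<phi>" for y
      unfolding N_def using that finite_free_vars[of \<phi>] by (simp add: less_Suc_eq_le Max_ge)
    let ?l = "map (\<lambda>y. if y \<in> free_vars \<phi> - {0} then e y else c) [0..<N]"
    have "?l \<in> lists (insert c A)" using p[OF x(1)] by auto
    moreover have "x = ?h (\<phi>, ?l)" unfolding x(2) normal_inst_def using N by auto
    ultimately show "x \<in> ?h ` (UNIV \<times> lists (insert c A))" by blast
  qed
  moreover have "countable (?h ` (UNIV \<times> lists (insert c A)))" using A by auto
  ultimately show ?thesis by (rule countable_subset)
qed

text \<open>The standard argument for countably incomplete ultrafilters. At the index \<open>t\<close>, realize as many of the first formulas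
as possible, but stop before \<open>t\<close> leaves one of the sets \<open>Z i\<close>; this leaves a
largest number \<open>N t\<close>, which exceeds every fixed \<open>i\<close> almost everywhere.\<close>

lemma (in ultrapower_struct) aleph1_saturated:
  fixes Z :: "nat \<Rightarrow> 'i set"
  assumes Z: "\<And>n. eventually (\<lambda>t. t \<in> Z n) D" "\<And>t. t \<in> I \<Longrightarrow> \<exists>n. t \<notin> Z n"
  shows "saturated (cardSuc natLeq) L U"
  unfolding saturated_def
proof (intro allI impI, elim conjE)
  fix A p assume A: "A \<subseteq> univ U" "|A| <o cardSuc natLeq" and p: "type_over L U A p"
  have "|A| \<le>o natLeq" using A(2) cardSuc_ordLeq_ordLess[OF natLeq_Card_order card_of_Card_order] by blast
  then have cA: "countable A" by (simp add: countable_card_le_natLeq)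
  obtain c where c: "c \<in> univ U" using is_struct_U unfolding is_struct_def by blast
  define p' where "p' = normal_inst c ` p"
  show "\<exists>b\<in>univ U. realizes U b p"
  proof (cases "p = {}")
    case True
    then show ?thesis using c unfolding realizes_def by blast
  next
    case False
    have pA: "wf_fm L \<phi>" "\<forall>y\<in>free_vars \<phi> - {0}. e y \<in> A" if "(\<phi>, e) \<in> p" for \<phi> e
      using p that unfolding type_over_def by blast+
    have p'U: "wf_fm L \<phi>" "e y \<in> univ U" if \<phi>e: "(\<phi>, e) \<in> p'" for \<phi> e y
    proof -
      obtain z where z: "z \<in> p" "(\<phi>, e) = normal_inst c z" using \<phi>e unfolding p'_def by blast
      obtain \<phi>0 e0 where "z = (\<phi>0, e0)" by (cases z)
      then have e0: "(\<phi>, e0) \<in> p" "e = (\<lambda>y. if y \<in> free_vars \<phi> - {0} then e0 y else c)"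
        using z unfolding normal_inst_def by simp_all
      show "wf_fm L \<phi>" by (rule pA(1)[OF e0(1)])
      show "e y \<in> univ U" using pA(2)[OF e0(1)] A(1) c unfolding e0(2) by (cases "y \<in> free_vars \<phi> - {0}") auto
    qed
    have "countable p'" unfolding p'_def using cA pA(2) by (intro countable_normal_insts) auto
    moreover have "p' \<noteq> {}" using False unfolding p'_def by blast
    ultimately obtain s :: "nat \<Rightarrow> ('i \<Rightarrow> 'a) set inst" where s: "range s = p'"
      by (metis range_from_nat_into)
    define \<psi> where "\<psi> = (\<lambda>n. fst (s n))"
    have s_mem: "(\<psi> n, snd (s n)) \<in> p'" for n using s unfolding \<psi>_def by auto
    have \<psi>: "wf_fm L (\<psi> n)" for n using p'U(1)[OF s_mem] .
    have E: "(\<lambda>(n, y). snd (s n) y) x \<in> univ U" for x using p'U(2)[OF s_mem] by (cases x) simp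
    obtain e where e: "\<And>x. e x \<in> G" "(\<lambda>(n, y). snd (s n) y) = (\<lambda>x. cls (e x))"
      by (rule representatives[where E = "\<lambda>(n, y). snd (s n) y", OF E]) (rule that)
    have s_e: "snd (s n) = (\<lambda>y. cls (e (n, y)))" for n
    proof
      fix y show "snd (s n) y = cls (e (n, y))" using fun_cong[OF e(2), of "(n, y)"] by simp
    qed
    \<comment> \<open>The condition on \<open>Z\<close> makes \<open>{n. t \<in> B n}\<close> finite, so that it has a maximum.\<close>
    define B where "B = (\<lambda>n. {t. (\<exists>a\<in>univ M. \<forall>i<n. sat M ((\<lambda>y. e (i, y) t)(0 := a)) (\<psi> i)) \<and> (\<forall>i<n. t \<in> Z i)})"
    have B: "eventually (\<lambda>t. t \<in> B n) D" for n
    proof -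
      have sub: "s ` {..<n} \<subseteq> normal_inst c ` p" using s unfolding p'_def by blast
      obtain q where q: "q \<subseteq> p" "finite q" "s ` {..<n} = normal_inst c ` q"
        using finite_subset_image[OF _ sub] by auto
      obtain b where b: "b \<in> univ U" "realizes U b q"
        using p q(1,2) unfolding type_over_def consistent_in_def by blast
      obtain h where h: "h \<in> G" "b = cls h" using b(1) unfolding univ_U by blast
      have "realizes U b (s ` {..<n})" unfolding q(3) realizes_normal_inst by (rule b(2))
      then have "sat U ((\<lambda>y. cls (e (i, y)))(0 := cls h)) (\<psi> i)" if "i < n" for i
        using that unfolding realizes_def h(2) \<psi>_def s_e[symmetric] by (auto split: prod.splits)
      then have "eventually (\<lambda>t. sat M ((\<lambda>y. e (i, y) t)(0 := h t)) (\<psi> i)) D" if "i < n" for i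
        using that Los_inst[of "\<lambda>y. e (i, y)", OF e(1) h(1) \<psi>] by blast
      then have "eventually (\<lambda>t. \<forall>i\<in>{..<n}. sat M ((\<lambda>y. e (i, y) t)(0 := h t)) (\<psi> i)) D"
        by (intro eventually_ball_finite) auto
      moreover have "eventually (\<lambda>t. \<forall>i\<in>{..<n}. t \<in> Z i) D"
        using Z(1) by (intro eventually_ball_finite) auto
      ultimately show ?thesis using ultrafilter_on_carrier[OF uf]
      proof eventually_elim
        case (elim t)
        then have "h t \<in> univ M" using h(1) by (auto simp: PiE_iff)
        then show ?case using elim unfolding B_def by blast
      qed
    qed
    define N where "N = (\<lambda>t. Max {n. t \<in> B n})"
    have N: "t \<in> B (N t)" "\<And>n. t \<in> B n \<Longrightarrow> n \<le> N t" if t: "t \<in> I" for t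
    proof -
      obtain m where m: "t \<notin> Z m" using Z(2)[OF t] by blast
      have "{n. t \<in> B n} \<subseteq> {..m}" using m unfolding B_def by (auto simp: not_le[symmetric])
      then have fin: "finite {n. t \<in> B n}" by (rule finite_subset) simp
      have "univ M \<noteq> {}" using struct unfolding is_struct_def by blast
      then have "0 \<in> {n. t \<in> B n}" unfolding B_def by auto
      then show "t \<in> B (N t)" using Max_in[OF fin] unfolding N_def by blast
      show "n \<le> N t" if "t \<in> B n" for n unfolding N_def using fin that by (intro Max_ge) auto
    qed
    have "\<forall>t. \<exists>a. t \<in> I \<longrightarrow> a \<in> univ M \<and> (\<forall>i<N t. sat M ((\<lambda>y. e (i, y) t)(0 := a)) (\<psi> i))"
      using N(1) unfolding B_def by blast
    from choice[OF this] obtain h0 where h0: "\<And>t. t \<in> I \<Longrightarrow> h0 t \<in> univ M"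
      "\<And>t i. t \<in> I \<Longrightarrow> i < N t \<Longrightarrow> sat M ((\<lambda>y. e (i, y) t)(0 := h0 t)) (\<psi> i)" by blast
    let ?h = "restrict h0 I"
    have h: "?h \<in> G" using h0(1) by auto
    have "sat U ((snd (s i))(0 := cls ?h)) (\<psi> i)" for i
    proof -
      have "eventually (\<lambda>t. sat M ((\<lambda>y. e (i, y) t)(0 := ?h t)) (\<psi> i)) D"
        using B[of "Suc i"] ultrafilter_on_carrier[OF uf]
      proof eventually_elim
        case (elim t)
        then have "i < N t" using N(2)[OF elim(2) elim(1)] by simp
        then show ?case using h0(2)[OF elim(2)] elim(2) by simp
      qed
      then show ?thesis unfolding s_e using Los_inst[of "\<lambda>y. e (i, y)", OF e(1) h \<psi>] by blast
    qed
    then have "realizes U (cls ?h) p'"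
      unfolding s[symmetric] realizes_def \<psi>_def by (auto split: prod.splits) (metis fst_conv snd_conv)
    then have "realizes U (cls ?h) p" unfolding p'_def realizes_normal_inst .
    moreover have "cls ?h \<in> univ U" using h unfolding univ_U by blast
    ultimately show ?thesis by blast
  qed
qed

text \<open>Terms over Skolem functions. Their values form the countable elementary substructure, and closure under
witnesses and under the functions of the language holds by construction.\<close>

datatype skolem = Base | Witness fm nat "skolem list" | Apply nat "skolem list"

instance skolem :: countable by countable_datatype

fun skolem_val :: "language \<Rightarrow> 'a struct \<Rightarrow> skolem \<Rightarrow> 'a" where
  "skolem_val L M Base = (SOME a. a \<in> univ M)"
| "skolem_val L M (Witness \<phi> x ts) =
     (let as = map (skolem_val L M) ts;
          e = (\<lambda>y. if y < length as then as ! y else SOME a. a \<in> univ M)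
      in if \<exists>a\<in>univ M. sat M (e(x := a)) \<phi> then SOME a. a \<in> univ M \<and> sat M (e(x := a)) \<phi>
         else SOME a. a \<in> univ M)"
| "skolem_val L M (Apply F ts) =
     (if fun_ar L F = Some (length ts) then fun_in M F (map (skolem_val L M) ts)
      else SOME a. a \<in> univ M)"

lemma skolem_val_in_univ:
  assumes "is_struct L M"
  shows "skolem_val L M s \<in> univ M"
proof (induction s)
  have base: "(SOME a. a \<in> univ M) \<in> univ M"
    using assms unfolding is_struct_def by (simp add: some_in_eq)
  case Base
  then show ?case using base by simp
next
  have base: "(SOME a. a \<in> univ M) \<in> univ M"
    using assms unfolding is_struct_def by (simp add: some_in_eq)
  case (Witness \<phi> x ts)
  let ?as = "map (skolem_val L M) ts"
  let ?P = "\<lambda>a. a \<in> univ M \<and> sat M ((\<lambda>y. if y < length ?as then ?as ! y else SOME a. a \<in> univ M)(x := a)) \<phi>"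
  have "Eps ?P \<in> univ M" if "\<exists>a. ?P a" using someI_ex[OF that] by blast
  then show ?case using base unfolding skolem_val.simps Let_def by (auto simp del: length_map)
next
  have base: "(SOME a. a \<in> univ M) \<in> univ M"
    using assms unfolding is_struct_def by (simp add: some_in_eq)
  case (Apply F ts)
  have "set (map (skolem_val L M) ts) \<subseteq> univ M" using Apply by auto
  then have "fun_in M F (map (skolem_val L M) ts) \<in> univ M" if "fun_ar L F = Some (length ts)"
    using assms that unfolding is_struct_def by (metis length_map)
  then show ?case using base by simp
qed

lemma tm_val_cong_fun_in: "fun_in N = fun_in M \<Longrightarrow> tm_val N e \<tau> = tm_val M e \<tau>"
proof (induction \<tau>)
  case (Fn F ts)
  then have "map (tm_val N e) ts = map (tm_val M e) ts" by (intro map_cong) auto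
  then show ?case using Fn.prems by (simp del: map_eq_conv)
qed simp

theorem downward_Loewenheim_Skolem:
  fixes M :: "'a struct"
  assumes M: "is_struct L M"
  obtains N :: "'a struct" where "countable (univ N)" "univ N \<subseteq> univ M" "is_struct L N"
    "\<And>e \<phi>. range e \<subseteq> univ N \<Longrightarrow> sat N e \<phi> \<longleftrightarrow> sat M e \<phi>"
proof
  let ?H = "range (skolem_val L M)"
  let ?N = "M\<lparr>univ := ?H\<rparr>"
  have H: "?H \<subseteq> univ M" using skolem_val_in_univ[OF M] by blast
  have lists: "\<exists>ts. as = map (skolem_val L M) ts" if "set as \<subseteq> ?H" for as
  proof -
    have "as \<in> lists ?H" using that by auto
    then show ?thesis unfolding lists_image by auto
  qed
  have tm: "tm_val ?N e \<tau> = tm_val M e \<tau>" for e \<tau> by (rule tm_val_cong_fun_in) simp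
  show "countable (univ ?N)" by simp
  show "univ ?N \<subseteq> univ M" using H by simp
  show "is_struct L ?N"
    unfolding is_struct_def
  proof (intro conjI allI impI)
    fix F as assume as: "fun_ar L F = Some (length as) \<and> set as \<subseteq> univ ?N"
    then obtain ts where "as = map (skolem_val L M) ts" using lists[of as] by auto
    then have "fun_in M F as = skolem_val L M (Apply F ts)" using as by simp
    then show "fun_in ?N F as \<in> univ ?N" by (metis rangeI select_convs(1,2) surjective update_convs(1))
  qed simp
  show "sat ?N e \<phi> \<longleftrightarrow> sat M e \<phi>" if "range e \<subseteq> univ ?N" for e \<phi>
    using that
  proof (induction \<phi> arbitrary: e)
    case (Eq \<sigma> \<tau>)
    then show ?case unfolding sat.simps tm by simp
  next
    case (Rel R ts)
    have m: "map (tm_val ?N e) ts = map (tm_val M e) ts" using tm by simp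
    show ?case unfolding sat.simps m by simp
  next
    case (Exists x \<phi>)
    have IH: "sat ?N (e(x := a)) \<phi> \<longleftrightarrow> sat M (e(x := a)) \<phi>" if "a \<in> ?H" for a
      using Exists.prems that by (intro Exists.IH) auto
    have "\<exists>a\<in>?H. sat M (e(x := a)) \<phi>" if b: "b \<in> univ M" "sat M (e(x := b)) \<phi>" for b
    proof -
      define k where "k = Suc (Max (insert 0 (free_vars \<phi>)))"
      have k: "y < k" if "y \<in> free_vars \<phi>" for y
        unfolding k_def using that finite_free_vars[of \<phi>] by (simp add: less_Suc_eq_le Max_ge)
      have "set (map e [0..<k]) \<subseteq> ?H" using Exists.prems by auto
      then obtain ts where ts: "map e [0..<k] = map (skolem_val L M) ts" using lists by blast
      let ?e = "\<lambda>y. if y < length (map e [0..<k]) then map e [0..<k] ! y else SOME a. a \<in> univ M"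
      have e: "sat M (?e(x := a)) \<phi> \<longleftrightarrow> sat M (e(x := a)) \<phi>" for a
        by (rule sat_cong) (use k in auto)
      have ex: "\<exists>a. a \<in> univ M \<and> sat M (?e(x := a)) \<phi>" using b e by blast
      have "skolem_val L M (Witness \<phi> x ts) = (SOME a. a \<in> univ M \<and> sat M (?e(x := a)) \<phi>)"
        unfolding skolem_val.simps Let_def ts[symmetric] using ex by (simp only: Bex_def if_True)
      then have "sat M (?e(x := skolem_val L M (Witness \<phi> x ts))) \<phi>" using someI_ex[OF ex] by simp
      then show ?thesis unfolding e by blast
    qed
    then have "(\<exists>a\<in>?H. sat M (e(x := a)) \<phi>) \<longleftrightarrow> (\<exists>a\<in>univ M. sat M (e(x := a)) \<phi>)" using H by blast
    then show ?case using IH by simp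
  qed auto
qed

text \<open>Ultrapowers of structures on the given type have sets of functions as elements; an injection on the universe
carries them back to that type as isomorphic copies.\<close>

definition transport :: "('a \<Rightarrow> 'b) \<Rightarrow> 'a struct \<Rightarrow> 'b struct" where
  "transport \<iota> M = \<lparr>univ = \<iota> ` univ M,
     fun_in = (\<lambda>F bs. \<iota> (fun_in M F (map (inv_into (univ M) \<iota>) bs))),
     rel_in = (\<lambda>R bs. rel_in M R (map (inv_into (univ M) \<iota>) bs))\<rparr>"

context
  fixes L :: language and M :: "'a struct" and \<iota> :: "'a \<Rightarrow> 'b"
  assumes M: "is_struct L M" and inj: "inj_on \<iota> (univ M)"
begin

lemma map_inv_transport: "set as \<subseteq> univ M \<Longrightarrow> map (inv_into (univ M) \<iota>) (map \<iota> as) = as"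
  using inv_into_f_f[OF inj] by (induction as) auto

lemma tm_val_in_range: "range e \<subseteq> univ M \<Longrightarrow> wf_tm L \<tau> \<Longrightarrow> tm_val M e \<tau> \<in> univ M"
  by (rule tm_val_in_univ[OF M]) auto

lemma tm_val_transport:
  assumes e: "range e \<subseteq> univ M"
  shows "wf_tm L \<tau> \<Longrightarrow> tm_val (transport \<iota> M) (\<lambda>y. \<iota> (e y)) \<tau> = \<iota> (tm_val M e \<tau>)"
proof (induction \<tau>)
  case (Fn F ts)
  have m: "map (tm_val (transport \<iota> M) (\<lambda>y. \<iota> (e y))) ts = map \<iota> (map (tm_val M e) ts)"
    using Fn by simp
  have "set (map (tm_val M e) ts) \<subseteq> univ M"
    using Fn.prems tm_val_in_range[OF e] by auto
  then show ?case unfolding tm_val.simps m by (simp add: transport_def map_inv_transport del: map_map)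
qed simp

lemma sat_transport:
  assumes "range e \<subseteq> univ M" "wf_fm L \<phi>"
  shows "sat (transport \<iota> M) (\<lambda>y. \<iota> (e y)) \<phi> \<longleftrightarrow> sat M e \<phi>"
  using assms
proof (induction \<phi> arbitrary: e)
  case (Eq \<sigma> \<tau>)
  have "tm_val M e \<sigma> \<in> univ M" "tm_val M e \<tau> \<in> univ M"
    using Eq.prems by (auto intro!: tm_val_in_range)
  then show ?case using Eq.prems inj by (simp add: tm_val_transport inj_on_eq_iff)
next
  case (Rel R ts)
  have m: "map (tm_val (transport \<iota> M) (\<lambda>y. \<iota> (e y))) ts = map \<iota> (map (tm_val M e) ts)"
    using Rel.prems by (simp add: tm_val_transport)
  have "set (map (tm_val M e) ts) \<subseteq> univ M"
    using Rel.prems tm_val_in_range[OF Rel.prems(1)] by auto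
  then show ?case unfolding sat.simps m by (simp add: transport_def map_inv_transport del: map_map)
next
  case (Exists x \<phi>)
  have "(\<lambda>y. \<iota> (e y))(x := \<iota> a) = (\<lambda>y. \<iota> ((e(x := a)) y))" for a by (rule ext) simp
  moreover have "sat (transport \<iota> M) (\<lambda>y. \<iota> ((e(x := a)) y)) \<phi> \<longleftrightarrow> sat M (e(x := a)) \<phi>" if "a \<in> univ M" for a
    using Exists.prems that by (intro Exists.IH) auto
  moreover have "univ (transport \<iota> M) = \<iota> ` univ M" by (simp add: transport_def)
  ultimately show ?case by simp
qed auto

lemma is_struct_transport: "is_struct L (transport \<iota> M)"
  unfolding is_struct_def
proof (intro conjI allI impI)
  show "univ (transport \<iota> M) \<noteq> {}" using M unfolding is_struct_def transport_def by simp
  fix F bs assume bs: "fun_ar L F = Some (length bs) \<and> set bs \<subseteq> univ (transport \<iota> M)"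
  then have "set (map (inv_into (univ M) \<iota>) bs) \<subseteq> univ M"
    by (auto simp: transport_def intro!: inv_into_into)
  then have "fun_in M F (map (inv_into (univ M) \<iota>) bs) \<in> univ M"
    using M bs unfolding is_struct_def by (metis length_map)
  then show "fun_in (transport \<iota> M) F bs \<in> univ (transport \<iota> M)" by (simp add: transport_def)
qed

lemma is_model_transport:
  assumes T: "T \<subseteq> sentences L" and mod: "is_model L T M"
  shows "is_model L T (transport \<iota> M)"
  unfolding is_model_def true_in_def
proof (intro conjI ballI allI impI is_struct_transport)
  fix \<phi> and e :: "nat \<Rightarrow> 'b" assume \<phi>: "\<phi> \<in> T" and e: "range e \<subseteq> univ (transport \<iota> M)"
  let ?e = "\<lambda>y. inv_into (univ M) \<iota> (e y)"
  have e': "e y \<in> \<iota> ` univ M" for y using e by (auto simp: transport_def)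
  then have "range ?e \<subseteq> univ M" by (auto intro: inv_into_into)
  moreover have "e = (\<lambda>y. \<iota> (?e y))" using e' by (simp add: f_inv_into_f)
  moreover have "wf_fm L \<phi>" using T \<phi> unfolding sentences_def by blast
  ultimately show "sat (transport \<iota> M) e \<phi>"
    using sat_transport[of ?e \<phi>] mod \<phi> unfolding is_model_def true_in_def by metis
qed

lemma saturated_transport:
  assumes sat: "saturated \<mu> L M"
  shows "saturated \<mu> L (transport \<iota> M)"
  unfolding saturated_def
proof (intro allI impI, elim conjE)
  fix A p assume A: "A \<subseteq> univ (transport \<iota> M)" "|A| <o \<mu>" and p: "type_over L (transport \<iota> M) A p"
  let ?inv = "inv_into (univ M) \<iota>"
  obtain c where c: "c \<in> univ M" using M unfolding is_struct_def by blast
  have univT: "univ (transport \<iota> M) = \<iota> ` univ M" by (simp add: transport_def)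
  define pull where "pull = (\<lambda>e :: nat \<Rightarrow> 'b. \<lambda>y. if e y \<in> \<iota> ` univ M then ?inv (e y) else c)"
  have pull_univ: "pull e y \<in> univ M" for e y unfolding pull_def using c by (auto intro: inv_into_into)
  have pA: "wf_fm L \<phi>" "\<forall>y\<in>free_vars \<phi> - {0}. e y \<in> A" if "(\<phi>, e) \<in> p" for \<phi> e
    using p that unfolding type_over_def by blast+
  have pull: "sat (transport \<iota> M) (e(0 := \<iota> b)) \<phi> \<longleftrightarrow> sat M ((pull e)(0 := b)) \<phi>"
    if "(\<phi>, e) \<in> p" "b \<in> univ M" for \<phi> e b
  proof -
    have "sat (transport \<iota> M) (e(0 := \<iota> b)) \<phi> \<longleftrightarrow>
        sat (transport \<iota> M) (\<lambda>y. \<iota> (((pull e)(0 := b)) y)) \<phi>"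
    proof (rule sat_cong)
      fix y assume y: "y \<in> free_vars \<phi>"
      show "(e(0 := \<iota> b)) y = \<iota> (((pull e)(0 := b)) y)"
      proof (cases "y = 0")
        case False
        then have "e y \<in> \<iota> ` univ M" using pA(2)[OF that(1)] y A(1) univT by blast
        then show ?thesis using False by (simp add: pull_def f_inv_into_f)
      qed simp
    qed
    also have "\<dots> \<longleftrightarrow> sat M ((pull e)(0 := b)) \<phi>"
      using pull_univ that(2) pA(1)[OF that(1)] by (intro sat_transport) auto
    finally show ?thesis .
  qed
  let ?b = "\<lambda>(\<phi>, e). (\<phi>, pull e)"
  have real: "realizes (transport \<iota> M) (\<iota> b) q \<longleftrightarrow> realizes M b (?b ` q)" if "q \<subseteq> p" "b \<in> univ M" for q b
    using that pull unfolding realizes_def by fast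
  have "type_over L M (?inv ` A) (?b ` p)"
    unfolding type_over_def
  proof (intro conjI)
    show "consistent_in M (?b ` p)"
      unfolding consistent_in_def
    proof (intro allI impI, elim conjE)
      fix q assume q: "q \<subseteq> ?b ` p" "finite q"
      obtain q' where q': "q' \<subseteq> p" "finite q'" "q = ?b ` q'"
        using finite_subset_image[OF q(2,1)] by (elim exE conjE bexE) (rule that)
      then obtain b' where "b' \<in> \<iota> ` univ M" "realizes (transport \<iota> M) b' q'"
        using p univT unfolding type_over_def consistent_in_def by metis
      then show "\<exists>b\<in>univ M. realizes M b q" using real[OF q'(1)] q'(3) by blast
    qed
    show "\<forall>(\<phi>, e)\<in>?b ` p. wf_fm L \<phi> \<and> (\<forall>y\<in>free_vars \<phi> - {0}. e y \<in> ?inv ` A)"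
    proof clarify
      fix \<phi> e assume \<phi>: "(\<phi>, e) \<in> p"
      have "pull e y \<in> ?inv ` A" if "y \<in> free_vars \<phi> - {0}" for y
      proof -
        have "e y \<in> A" using pA(2)[OF \<phi>] that by blast
        moreover from this have "pull e y = ?inv (e y)" using A(1) univT unfolding pull_def by auto
        ultimately show ?thesis by blast
      qed
      then show "wf_fm L \<phi> \<and> (\<forall>y\<in>free_vars \<phi> - {0}. pull e y \<in> ?inv ` A)" using pA(1)[OF \<phi>] by blast
    qed
  qed
  moreover have "?inv ` A \<subseteq> univ M" using A(1) univT by (auto intro: inv_into_into)
  moreover have "|?inv ` A| <o \<mu>" by (rule ordLeq_ordLess_trans[OF card_of_image A(2)])
  ultimately obtain b where "b \<in> univ M" "realizes M b (?b ` p)" using sat unfolding saturated_def by blast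
  then show "\<exists>b\<in>univ (transport \<iota> M). realizes (transport \<iota> M) b p" using real[of p b] univT by blast
qed

end

text \<open>The passage to a countable elementary submodel keeps the universe small enough for the given type: its
ultrapower over the natural numbers has at most continuum many elements.\<close>

theorem aleph1_saturated_model_exists:
  fixes M :: "'m struct"
  assumes T: "T \<subseteq> sentences L" and M: "is_model L T M"
    and univ: "|UNIV :: nat set set| \<le>o |UNIV :: 'm set|"
  shows "\<exists>N :: 'm struct. is_model L T N \<and> saturated (cardSuc natLeq) L N"
proof -
  have "is_struct L M" using M unfolding is_model_def by blast
  then obtain N :: "'m struct" where N: "countable (univ N)" "univ N \<subseteq> univ M" "is_struct L N"
    "\<And>e \<phi>. range e \<subseteq> univ N \<Longrightarrow> sat N e \<phi> \<longleftrightarrow> sat M e \<phi>"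
    by (rule downward_Loewenheim_Skolem) (rule that)
  have Nmod: "is_model L T N"
    using N(2-4) M unfolding is_model_def true_in_def by (meson order_trans)
  obtain D :: "nat filter" where D: "ultrafilter_on UNIV D" "regular_filter UNIV D"
    using flexible_ultrafilter_exists[OF infinite_UNIV_nat] by blast
  obtain Z :: "nat \<Rightarrow> nat set" where Z: "\<And>n. eventually (\<lambda>t. t \<in> Z n) D" "\<And>t. t \<in> UNIV \<Longrightarrow> \<exists>n. t \<notin> Z n"
    using countably_incomplete_of_regular[OF infinite_UNIV_nat D(2)] by blast
  interpret ultrapower_struct UNIV D L N using D(1) N(3) by unfold_locales
  have "|univ U| \<le>o |G|" unfolding univ_U by (rule card_of_image)
  moreover have "|G| \<le>o |(UNIV :: nat set) \<rightarrow>\<^sub>E (UNIV :: nat set)|"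
  proof (rule card_of_ordLeqI[where f = "\<lambda>f t. to_nat_on (univ N) (f t)"])
    show "inj_on (\<lambda>f t. to_nat_on (univ N) (f t)) G"
    proof (rule inj_onI)
      fix f g assume fg: "f \<in> G" "g \<in> G" "(\<lambda>t. to_nat_on (univ N) (f t)) = (\<lambda>t. to_nat_on (univ N) (g t))"
      show "f = g"
      proof
        fix t
        have "f t \<in> univ N" "g t \<in> univ N" using fg(1,2) by auto
        then show "f t = g t" using fun_cong[OF fg(3), of t] inj_on_to_nat_on[OF N(1)] by (simp add: inj_on_eq_iff)
      qed
    qed
  qed simp
  moreover have "|(UNIV :: nat set) \<rightarrow>\<^sub>E (UNIV :: nat set)| \<le>o |Pow (UNIV :: nat set)|"
    by (rule card_of_funcset_nat) simp
  ultimately have "|univ U| \<le>o |Pow (UNIV :: nat set)|" by (meson ordLeq_transitive)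
  then have "|univ U| \<le>o |UNIV :: 'm set|" using univ ordLeq_transitive unfolding Pow_UNIV by blast
  then obtain \<iota> :: "_ \<Rightarrow> 'm" where \<iota>: "inj_on \<iota> (univ U)" unfolding card_of_ordLeq[symmetric] by blast
  have "is_model L T (transport \<iota> U)"
    by (rule is_model_transport[OF is_struct_U \<iota> T is_model_U[OF T Nmod]])
  moreover have "saturated (cardSuc natLeq) L (transport \<iota> U)"
    by (rule saturated_transport[OF is_struct_U \<iota> aleph1_saturated[OF Z]])
  ultimately show ?thesis by blast
qed

section \<open>Loss of saturation\<close>

lemma chain_branch:
  assumes "finite S" and chain: "\<And>l l'. l \<in> S \<Longrightarrow> l' \<in> S \<Longrightarrow> \<not> l \<parallel> l'"
  shows "\<exists>\<eta> :: nat \<Rightarrow> bool. \<forall>l\<in>S. l = map \<eta> [0..<length l]"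
proof (cases "S = {}")
  case False
  have "Max (length ` S) \<in> length ` S" using assms(1) False by (intro Max_in) auto
  then obtain m where m: "m \<in> S" "length m = Max (length ` S)" by auto
  then have max: "length l \<le> length m" if "l \<in> S" for l using that assms(1) by simp
  have "l = map (\<lambda>i. m ! i) [0..<length l]" if l: "l \<in> S" for l
  proof -
    have "prefix l m"
    proof (cases "prefix m l")
      case True
      then show ?thesis using max[OF l] by (auto simp: prefix_def)
    next
      case False
      then show ?thesis using chain[OF l m(1)] by (auto simp: parallel_def)
    qed
    then show ?thesis by (auto simp: prefix_def intro!: nth_equalityI simp: nth_append)
  qed
  then show ?thesis by blast
qed simp

context ultrapower_struct
begin

text \<open>The type consists of the formulas attached to the nodes of the branch. It is finitely satisfiable
because finitely many pairwise comparable nodes lie on one infinite branch of the \<open>SOP\<^sub>2\<close> tree. The sets on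
which a realization satisfies the single formulas would bound the branch.\<close>

lemma not_saturated_unbounded_branch:
  fixes \<mu> :: "'c rel" and a :: "bool list \<Rightarrow> nat \<Rightarrow> 'a"
  assumes \<mu>: "Card_order \<mu>" "infinite (Field \<mu>)" and W: "|W| \<le>o \<mu>"
    and br: "unbounded_branch I D W node"
    and wf: "wf_fm L \<phi>" and a: "\<And>\<eta>. range (a \<eta>) \<subseteq> univ M"
    and incons: "\<And>\<eta> \<rho>. \<eta> \<parallel> \<rho> \<Longrightarrow> \<not> consistent_in M {(\<phi>, a \<eta>), (\<phi>, a \<rho>)}"
    and cons: "\<And>\<eta> :: nat \<Rightarrow> bool. consistent_in M {(\<phi>, a (map \<eta> [0..<i])) | i. True}"
  shows "\<not> saturated (cardSuc \<mu>) L U"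
proof
  assume sat: "saturated (cardSuc \<mu>) L U"
  define h where "h = (\<lambda>\<alpha> y. \<lambda>x\<in>I. a (node \<alpha> x) y)"
  have h: "h \<alpha> y \<in> G" for \<alpha> y using a unfolding h_def by auto
  define E where "E = (\<lambda>\<alpha> y. cls (h \<alpha> y))"
  let ?A = "(\<lambda>(\<alpha>, y). E \<alpha> y) ` (W \<times> (UNIV :: nat set))"
  let ?p = "(\<lambda>\<alpha>. (\<phi>, E \<alpha>)) ` W"
  have val: "sat U ((E \<alpha>)(0 := cls B)) \<phi> \<longleftrightarrow> eventually (\<lambda>x. sat M ((a (node \<alpha> x))(0 := B x)) \<phi>) D"
    if B: "B \<in> G" for \<alpha> B
  proof -
    have "eventually (\<lambda>x. sat M ((\<lambda>y. h \<alpha> y x)(0 := B x)) \<phi> = sat M ((a (node \<alpha> x))(0 := B x)) \<phi>) D"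
      using ultrafilter_on_carrier[OF uf] by eventually_elim (simp add: h_def)
    then show ?thesis
      unfolding E_def Los_inst[of "h \<alpha>", OF h B wf] by (rule eventually_subst)
  qed
  have "|W \<times> (UNIV :: nat set)| \<le>o \<mu>"
  proof (rule card_of_Sigma_ordLeq_infinite_Field[OF \<mu>(2,1) W], intro ballI)
    have "|UNIV :: nat set| \<le>o |Field \<mu>|" using \<mu>(2) infinite_iff_card_of_nat by blast
    then show "|UNIV :: nat set| \<le>o \<mu>" by (rule ordLeq_ordIso_trans[OF _ card_of_Field_ordIso[OF \<mu>(1)]])
  qed
  then have "|?A| \<le>o \<mu>" by (rule ordLeq_transitive[OF card_of_image])
  then have cA: "|?A| <o cardSuc \<mu>" by (rule ordLeq_ordLess_trans[OF _ cardSuc_greater[OF \<mu>(1)]])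
  have AU: "?A \<subseteq> univ U" unfolding univ_U E_def using h by auto
  have "consistent_in U ?p"
    unfolding consistent_in_def
  proof (intro allI impI, elim conjE)
    fix q assume q: "q \<subseteq> ?p" "finite q"
    obtain S where S: "S \<subseteq> W" "finite S" "q = (\<lambda>\<alpha>. (\<phi>, E \<alpha>)) ` S"
      using finite_subset_image[OF q(2,1)] by (elim exE conjE bexE) (rule that)
    have "eventually (\<lambda>x. \<forall>\<alpha>\<in>S. \<forall>\<beta>\<in>S. \<not> node \<alpha> x \<parallel> node \<beta> x) D"
      using S(1,2) br unfolding unbounded_branch_def by (intro eventually_ball_finite ballI) auto
    then have ev: "eventually (\<lambda>x. \<exists>b\<in>univ M. \<forall>\<alpha>\<in>S. sat M ((a (node \<alpha> x))(0 := b)) \<phi>) D"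
    proof eventually_elim
      case (elim x)
      have "\<exists>\<eta> :: nat \<Rightarrow> bool. \<forall>l\<in>(\<lambda>\<alpha>. node \<alpha> x) ` S. l = map \<eta> [0..<length l]"
        using S(2) elim by (intro chain_branch) auto
      then obtain \<eta> :: "nat \<Rightarrow> bool" where \<eta>: "\<And>\<alpha>. \<alpha> \<in> S \<Longrightarrow> node \<alpha> x = map \<eta> [0..<length (node \<alpha> x)]"
        by blast
      let ?q = "(\<lambda>\<alpha>. (\<phi>, a (node \<alpha> x))) ` S"
      have "(\<phi>, a (node \<alpha> x)) = (\<phi>, a (map \<eta> [0..<length (node \<alpha> x)]))" if "\<alpha> \<in> S" for \<alpha>
        by (rule arg_cong[OF \<eta>[OF that]])
      then have "?q \<subseteq> {(\<phi>, a (map \<eta> [0..<i])) | i. True}" by blast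
      moreover have "finite ?q" using S(2) by blast
      ultimately obtain b where "b \<in> univ M" "realizes M b ?q"
        using cons[of \<eta>] unfolding consistent_in_def by blast
      then show ?case unfolding realizes_def by blast
    qed
    obtain c where c: "c \<in> univ M" using struct unfolding is_struct_def by blast
    have "\<forall>x. \<exists>b. b \<in> univ M \<and> ((\<exists>b\<in>univ M. \<forall>\<alpha>\<in>S. sat M ((a (node \<alpha> x))(0 := b)) \<phi>) \<longrightarrow>
        (\<forall>\<alpha>\<in>S. sat M ((a (node \<alpha> x))(0 := b)) \<phi>))" using c by blast
    from choice[OF this] obtain B where B: "\<And>x. B x \<in> univ M"
      "\<And>x. \<exists>b\<in>univ M. \<forall>\<alpha>\<in>S. sat M ((a (node \<alpha> x))(0 := b)) \<phi> \<Longrightarrow>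
        \<forall>\<alpha>\<in>S. sat M ((a (node \<alpha> x))(0 := B x)) \<phi>" by blast
    let ?B = "restrict B I"
    have BG: "?B \<in> G" using B(1) by auto
    have "sat U ((E \<alpha>)(0 := cls ?B)) \<phi>" if \<alpha>: "\<alpha> \<in> S" for \<alpha>
      unfolding val[OF BG] using ev ultrafilter_on_carrier[OF uf]
    proof eventually_elim
      case (elim x)
      then show ?case using B(2)[OF elim(1)] \<alpha> by simp
    qed
    then have "realizes U (cls ?B) q" unfolding S(3) realizes_def by blast
    then show "\<exists>b\<in>univ U. realizes U b q" using BG unfolding univ_U by blast
  qed
  moreover have "\<forall>(\<phi>, e)\<in>?p. wf_fm L \<phi> \<and> (\<forall>y\<in>free_vars \<phi> - {0}. e y \<in> ?A)" using wf by auto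
  ultimately have "type_over L U ?A ?p" unfolding type_over_def by blast
  then obtain b where b: "b \<in> univ U" "realizes U b ?p"
    using sat AU cA unfolding saturated_def by blast
  then obtain B where B: "B \<in> G" "b = cls B" unfolding univ_U by blast
  let ?X = "\<lambda>\<alpha>. {x \<in> I. sat M ((a (node \<alpha> x))(0 := B x)) \<phi>}"
  have "?X \<alpha> \<in> fsets I D" if "\<alpha> \<in> W" for \<alpha>
    unfolding fsets_Collect_iff[OF uf] val[OF B(1), symmetric]
    using b(2) that unfolding realizes_def B(2) by blast
  then obtain \<alpha> \<beta> x where x: "x \<in> ?X \<alpha> \<inter> ?X \<beta>" "node \<alpha> x \<parallel> node \<beta> x"
    using br unfolding unbounded_branch_def by meson
  have "B x \<in> univ M" using B(1) x(1) by (auto simp: PiE_iff)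
  then have "consistent_in M {(\<phi>, a (node \<alpha> x)), (\<phi>, a (node \<beta> x))}"
    using x(1) unfolding consistent_in_def realizes_def by blast
  then show False using incons[OF x(2)] by blast
qed

end

theorem mainTheorem10:
  fixes kappa :: "'k rel" and lambda :: "'i rel"
  assumes "Card_order kappa" and "Card_order lambda" and "kappa <o lambda"
    and "measurable_cardinal kappa"
    and universe: "|UNIV :: nat set set| \<le>o |UNIV :: 'm set|"
  shows "\<exists>(I :: 'i set) (D :: 'i filter).
           |I| =o lambda \<and> ultrafilter_on I D \<and> regular_filter I D \<and>
           flexible lambda I D \<and> \<not> good I D \<and>
           (\<forall>L T. complete_theory TYPE('m) L T \<and> SOP2 TYPE('m) L T \<longrightarrow>
              \<not> (\<forall>M :: 'm struct. is_model L T M \<longrightarrow>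
                    saturated (cardSuc lambda) L (ultrapower I D M)))"
proof -
  let ?I = "Field lambda"
  obtain E where unc: "natLeq <o kappa" and E: "ultrafilter_on (Field kappa) E"
      "\<forall>a\<in>Field kappa. {a} \<notin> fsets (Field kappa) E"
      "\<forall>\<A>. \<A> \<subseteq> fsets (Field kappa) E \<and> \<A> \<noteq> {} \<and> |\<A>| <o kappa \<longrightarrow>
         \<Inter>\<A> \<in> fsets (Field kappa) E"
    using assms(4) unfolding measurable_cardinal_def by (elim exE conjE) (rule that)
  interpret complete_ultrafilter kappa E
    by (rule complete_ultrafilter.intro[OF assms(1) unc E(1)]) (simp_all add: E(2,3))
  have I: "|?I| =o lambda" by (rule card_of_Field_ordIso[OF assms(2)])
  have "|Field kappa| \<le>o |?I|"
    using assms(3) ordLess_imp_ordLeq ordIso_ordLeq_trans[OF card_of_Field_ordIso[OF assms(1)]]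
      ordLeq_ordIso_trans[OF _ ordIso_symmetric[OF I]] by meson
  then have inf: "infinite ?I" and "|?I \<times> Field kappa| =o |?I|"
    using infinite_Field card_of_ordLeq_infinite[of "Field kappa" ?I] infinite_imp_nonempty[OF infinite_Field]
      card_of_Times_infinite[of ?I "Field kappa"] by auto
  then obtain b where b: "bij_betw b (?I \<times> Field kappa) ?I" unfolding card_of_ordIso[symmetric] by blast
  obtain F where F: "ultrafilter_on ?I F" "regular_filter ?I F" "flexible lambda ?I F"
    using flexible_ultrafilter_exists[OF inf] by blast
  let ?D = "fubini b F E"
  have D: "ultrafilter_on ?I ?D" by (rule ultrafilter_on_fubini[OF b F(1) ultrafilter])
  obtain W node where W: "W \<subseteq> ?I" and br: "unbounded_branch ?I ?D W node"
    using unbounded_branch_fubini[OF assms(2,3) b F(1,2)] by blast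
  have cW: "|W| \<le>o lambda" by (rule ordLeq_ordIso_trans[OF card_of_mono1[OF W] I])
  have "\<not> (\<forall>M :: 'm struct. is_model L T M \<longrightarrow> saturated (cardSuc lambda) L (ultrapower ?I ?D M))"
    if LT: "complete_theory TYPE('m) L T" "SOP2 TYPE('m) L T" for L T
  proof -
    obtain M0 :: "'m struct" where T: "T \<subseteq> sentences L" and M0: "is_model L T M0"
      using LT(1) unfolding complete_theory_def by blast
    obtain M :: "'m struct" where M: "is_model L T M" "saturated (cardSuc natLeq) L M"
      using aleph1_saturated_model_exists[OF T M0 universe] by blast
    obtain \<phi> where \<phi>: "wf_fm L \<phi>"
      "\<forall>M :: 'm struct. is_model L T M \<and> saturated (cardSuc natLeq) L M \<longrightarrow>
           (\<exists>a :: bool list \<Rightarrow> nat \<Rightarrow> 'm.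
              (\<forall>\<eta>. range (a \<eta>) \<subseteq> univ M) \<and>
              (\<forall>\<eta> \<rho>. \<eta> \<parallel> \<rho> \<longrightarrow> \<not> consistent_in M {(\<phi>, a \<eta>), (\<phi>, a \<rho>)}) \<and>
              (\<forall>\<eta> :: nat \<Rightarrow> bool. consistent_in M {(\<phi>, a (map \<eta> [0..<i])) | i. True}))"
      using LT(2) unfolding SOP2_def by (elim exE conjE) (rule that)
    obtain a :: "bool list \<Rightarrow> nat \<Rightarrow> 'm" where a: "\<forall>\<eta>. range (a \<eta>) \<subseteq> univ M"
        "\<forall>\<eta> \<rho>. \<eta> \<parallel> \<rho> \<longrightarrow> \<not> consistent_in M {(\<phi>, a \<eta>), (\<phi>, a \<rho>)}"
        "\<forall>\<eta> :: nat \<Rightarrow> bool. consistent_in M {(\<phi>, a (map \<eta> [0..<i])) | i. True}"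
      using mp[OF spec[OF \<phi>(2), of M] conjI[OF M]] by (elim exE conjE) (rule that)
    interpret U: ultrapower_struct ?I ?D L M
      using D M(1) unfolding is_model_def by unfold_locales blast+
    have "\<not> saturated (cardSuc lambda) L (ultrapower ?I ?D M)"
      by (rule U.not_saturated_unbounded_branch[where a = a, OF assms(2) inf cW br \<phi>(1)]) (use a in blast)+
    then show ?thesis using M(1) by blast
  qed
  then show ?thesis
    using I D regular_filter_fubini[OF b F(1) ultrafilter F(2)] flexible_fubini[OF b F(1,3)]
      not_good_unbounded_branch[OF D W br] by blast
qed

end
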